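(* Let $n\ge2$. There exists a constant $c_n>0$ depending only on $n$ such that the following holds. Let $\delta\in(0,1)$, $1\le p<\frac n\delta$ and $w\in A_1$. Then $$\left(\frac1{w(B)}\int_B|f(x)-f_B|^{p\left(\frac n\delta\right)'}w(x)\,dx\right)^{\frac1{p\left(\frac n\delta\right)'}}\le c_n\,\frac{(1-\delta)^{\frac1p}}{\delta^{1+\frac1{p'}}}\,[w]_{A_1}^{\frac1p}\,r(B)^\delta\left(\frac1{w(B)}\int_B\int_B\frac{|f(x)-f(y)|^p}{|x-y|^{n+\delta p}}\,dy\,w(x)\,dx\right)^{\frac1p}$$ for any ball $B\subset\mathbb{R}^n$ and any $f\in L^1(B)$.
   Context: A weight is a non-negative locally integrable function on $\mathbb{R}^n$; $w(B)=\int_B w$; $r(B)$ is the radius of the ball $B$; $f_B=\frac1{|B|}\int_Bf$. For $s\ge 1$, $s'$ is the conjugate exponent, $\frac1s+\frac1{s'}=1$ (so $\frac1{p'}=0$ if $p=1$, and $\left(\frac n\delta\right)'=\frac n{n-\delta}$). $w\in A_1$ means $[w]_{A_1}=\|Mw/w\|_{L^\infty}<\infty$, where $Mw(x)=\sup_B\left(\frac1{|B|}\int_B|w|\right)\chi_B(x)$, supremum over all balls, is the Hardy–Littlewood maximal function. *)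

theory Defs
  imports "HOL-Analysis.Analysis" "HOL-Probability.Essential_Supremum"
begin

text \<open>With the convention \<open>1 / 0 = 0\<close>, the equation \<open>1 / s + 1 / conj_exp s = 1\<close> holds
  for every \<open>s \<ge> 1\<close>: the value \<open>conj_exp 1 = 0\<close> stands for the exponent infinity, and
  only its reciprocal is ever meaningful.\<close>

definition conj_exp :: "real \<Rightarrow> real" where
  "conj_exp s = s / (s - 1)"

lemma conj_exp_eq: "1 \<le> s \<Longrightarrow> 1 / s + 1 / conj_exp s = 1"
  by (simp add: conj_exp_def field_simps)

lemma inverse_conj_exp_1: "1 / conj_exp 1 = 0"
  by (simp add: conj_exp_def)

lemma conj_exp_div: "0 < d \<Longrightarrow> d < n \<Longrightarrow> conj_exp (n / d) = n / (n - d)"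
  by (simp add: conj_exp_def field_simps)

text \<open>Integrals of nonnegative functions are taken in \<open>[0, \<infinity>]\<close>, so that they may diverge.
  The power below is intended for positive exponents only.\<close>

definition enn_powr :: "ennreal \<Rightarrow> real \<Rightarrow> ennreal" (infixr "epowr" 80) where
  "x epowr a = (if x = \<infinity> then \<infinity> else ennreal (enn2real x powr a))"

lemma ennreal_epowr: "0 \<le> x \<Longrightarrow> ennreal x epowr a = ennreal (x powr a)"
  by (simp add: enn_powr_def)

definition weight :: "('a::euclidean_space \<Rightarrow> real) \<Rightarrow> bool" where
  "weight w \<longleftrightarrow> (\<forall>x. 0 \<le> w x) \<and> (\<forall>K. compact K \<longrightarrow> set_integrable lebesgue K w)"

definition wmeas :: "('a::euclidean_space \<Rightarrow> real) \<Rightarrow> 'a set \<Rightarrow> ennreal" where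
  "wmeas w B = (\<integral>\<^sup>+x\<in>B. ennreal (w x) \<partial>lebesgue)"

definition avg :: "('a::euclidean_space \<Rightarrow> real) \<Rightarrow> 'a set \<Rightarrow> real" where
  "avg f B = (LINT x:B|lebesgue. f x) / measure lebesgue B"

text \<open>Taking the supremum over open or over closed balls gives the same function, since a closed
  ball is the intersection of slightly larger open balls.\<close>

definition maximal_fun :: "('a::euclidean_space \<Rightarrow> real) \<Rightarrow> 'a \<Rightarrow> ennreal" where
  "maximal_fun w x =
     (SUP B \<in> {ball z r | z r. 0 < r}.
        (\<integral>\<^sup>+y\<in>B. ennreal \<bar>w y\<bar> \<partial>lebesgue) / emeasure lebesgue B * indicator B x)"

text \<open>The quotient is taken in \<open>[0, \<infinity>]\<close>, where \<open>a / 0 = \<infinity>\<close> for \<open>a > 0\<close>, and \<open>0 / 0 = 0\<close>.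
  The case \<open>0 / 0\<close> arises only if \<open>w\<close> vanishes almost everywhere, because otherwise its maximal
  function is positive everywhere.\<close>

definition A1_const :: "('a::euclidean_space \<Rightarrow> real) \<Rightarrow> ennreal" where
  "A1_const w = esssup lebesgue (\<lambda>x. maximal_fun w x / ennreal (w x))"

definition A1 :: "('a::euclidean_space \<Rightarrow> real) set" where
  "A1 = {w. weight w \<and> A1_const w < \<infinity>}"

end

theory Submission
  imports Defs
begin

text \<open>
  For \<open>x \<in> B\<close> let \<open>B\<^sub>k\<close> be the image of \<open>B\<close> under the homothety with centre \<open>x\<close> and ratio \<open>1 / 2^k\<close>;
  these balls lie in \<open>B\<close> even for \<open>x\<close> near the boundary. Telescoping the averages over the \<open>B\<^sub>k\<close>
  and applying to each of them a Poincare inequality with the factor \<open>1 - \<delta>\<close> bounds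
  \<open>\<bar>f(x) - f\<^sub>B\<bar>^p\<close> by a dyadic Riesz potential of the fractional gradient
  \<open>G(x) = \<integral>\<^sub>B \<bar>f(x) - f(y)\<bar>^p / \<bar>x - y\<bar>^(n + \<delta>p) dy\<close>. That inequality on a ball comes from iterating the
  midpoint estimate \<open>\<bar>f(x) - f(y)\<bar> \<le> \<bar>f(x) - f(m)\<bar> + \<bar>f(m) - f(y)\<bar>\<close> and averaging over the scales
  \<open>2^-j\<close> with the weights \<open>2^(-j p (1 - \<delta>))\<close>.

  Integrating the potential against \<open>w\<close> over a level set and exchanging the integrals, the
  \<open>A\<^sub>1\<close> condition gives the weak type estimate with the exponent \<open>p (n/\<delta>)'\<close>. Since the truncations
  \<open>f\<^sub>k\<close> of \<open>\<bar>f - f\<^sub>B\<bar>\<close> to dyadic layers satisfy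
  \<open>\<Sum>\<^sub>k \<bar>f\<^sub>k(x) - f\<^sub>k(y)\<bar>^p \<le> \<bar>f(x) - f(y)\<bar>^p\<close>, Maz'ya's truncation method turns it into the strong
  type estimate, even with \<open>1 / \<delta>\<close> in place of \<open>1 / \<delta>^(1 + 1/p')\<close>.
\<close>

section \<open>Elementary inequalities\<close>

text \<open>Stands in for Hoelder's and Jensen's inequalities: one integrates this bound and then
  chooses \<open>s\<close>.\<close>

lemma le_young_powr:
  fixes s t p :: real
  assumes "0 < s" "0 \<le> t" "1 \<le> p"
  shows "t \<le> s powr (1 - p) * t powr p + s"
proof (cases "t \<le> s")
  case True
  then show ?thesis by (smt (verit) mult_nonneg_nonneg powr_ge_zero)
next
  case False
  have "t = s powr (1 - p) * (s powr (p - 1) * t)"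
    using assms by (simp flip: powr_add mult.assoc)
  also have "\<dots> \<le> s powr (1 - p) * (t powr (p - 1) * t)"
    using assms False by (intro mult_left_mono mult_right_mono powr_mono2) auto
  also have "t powr (p - 1) * t = t powr p"
    using assms False by (metis diff_add_cancel not_le powr_add powr_one order_less_le_trans)
  finally show ?thesis using assms by simp
qed

text \<open>Convexity of the \<open>p\<close>-th power at the midpoint of \<open>a\<close> and
  \<open>b\<close>. If one of them is zero, \<open>1 \<le> 2 powr (p - 1)\<close> is enough.\<close>

lemma powr_sum_le:
  fixes a b p :: real
  assumes "0 \<le> a" "0 \<le> b" "1 \<le> p"
  shows "(a + b) powr p \<le> 2 powr (p - 1) * (a powr p + b powr p)"
proof (cases "a = 0 \<or> b = 0")
  case True
  have "1 \<le> (2::real) powr (p - 1)" using assms by (simp add: ge_one_powr_ge_zero)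
  then have "x \<le> 2 powr (p - 1) * x" if "0 \<le> x" for x :: real
    using that mult_right_mono[of 1 "2 powr (p-1)" x] by simp
  then show ?thesis using True by auto
next
  case False
  have "((1 - 1/2) *\<^sub>R a + (1/2) *\<^sub>R b) powr p \<le> (1 - 1/2) * a powr p + (1/2) * b powr p"
    using False assms by (intro convex_onD[OF powr_convex]) auto
  then have "((a + b) / 2) powr p \<le> (a powr p + b powr p) / 2"
    by (simp add: field_simps)
  moreover have "(a + b) powr p = 2 powr p * ((a + b) / 2) powr p"
    using assms by (simp flip: powr_mult add: add_divide_distrib)
  moreover have "(2::real) powr p = 2 powr (p - 1) * 2"
    by (metis diff_add_cancel powr_add powr_one zero_le_numeral)
  ultimately have "(a + b) powr p = 2 powr (p - 1) * (2 * ((a + b) / 2) powr p)"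
    "2 * ((a + b) / 2) powr p \<le> a powr p + b powr p"
    by simp_all
  then show ?thesis by (simp add: mult_left_mono)
qed

text \<open>The constant \<open>c\<close> is its own average, so the difference on the left is the
  average of \<open>c - f\<close>. The bound is a nonnegative integral, which lets the later
  estimates stay in [0, \<infinity>] without integrability of any \<open>p\<close>-th power.\<close>

lemma abs_diff_avg_le:
  fixes f :: "'a::euclidean_space \<Rightarrow> real"
  assumes "set_integrable lborel S f" and [measurable]: "S \<in> sets borel"
    and "emeasure lborel S \<noteq> \<infinity>" "emeasure lborel S \<noteq> 0"
  shows "ennreal \<bar>c - (LINT x:S|lborel. f x) / measure lborel S\<bar>
    \<le> (\<integral>\<^sup>+x\<in>S. ennreal \<bar>c - f x\<bar> \<partial>lborel) / emeasure lborel S"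
proof -
  let ?m = "measure lborel S"
  have m: "emeasure lborel S = ennreal ?m" "0 < ?m"
    using assms by (auto simp: emeasure_eq_ennreal_measure zero_less_measure_iff)
  have c: "set_integrable lborel S (\<lambda>_. c)"
    using assms by (simp add: set_integrable_def less_top)
  have d: "set_integrable lborel S (\<lambda>x. c - f x)"
    by (rule set_integral_diff(1)[OF c assms(1)])
  have "(LINT x:S|lborel. c - f x) = c * ?m - (LINT x:S|lborel. f x)"
    by (subst set_integral_diff(2)[OF c assms(1)]) (simp add: set_lebesgue_integral_def mult.commute)
  then have "c - (LINT x:S|lborel. f x) / ?m = (LINT x:S|lborel. c - f x) / ?m"
    using m by (simp add: field_simps)
  also have "\<bar>\<dots>\<bar> \<le> (LINT x:S|lborel. \<bar>c - f x\<bar>) / ?m"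
    using m d by (simp add: divide_right_mono set_integral_norm_bound[of lborel S "\<lambda>x. c - f x", simplified])
  finally have "ennreal \<bar>c - (LINT x:S|lborel. f x) / ?m\<bar> \<le> ennreal ((LINT x:S|lborel. \<bar>c - f x\<bar>) / ?m)"
    by (rule ennreal_leI)
  also have "\<dots> = ennreal (LINT x:S|lborel. \<bar>c - f x\<bar>) / ennreal ?m"
    using m by (intro divide_ennreal[symmetric]) (auto simp: set_lebesgue_integral_def)
  also have "ennreal (LINT x:S|lborel. \<bar>c - f x\<bar>) = (\<integral>\<^sup>+x\<in>S. ennreal \<bar>c - f x\<bar> \<partial>lborel)"
    unfolding set_lebesgue_integral_def using set_integrable_abs[OF d]
    by (subst nn_integral_eq_integral[symmetric])
      (auto simp: set_integrable_def intro!: nn_integral_cong split: split_indicator)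
  finally show ?thesis by (simp add: m)
qed

text \<open>The map from \<open>y\<close> to the midpoint of \<open>x\<close> and \<open>y\<close>
  contracts volumes by \<open>1 / 2 ^ DIM('a)\<close>.\<close>

lemma nn_integral_midpoint:
  fixes h :: "'a::euclidean_space \<Rightarrow> ennreal"
  assumes [measurable]: "h \<in> borel_measurable borel"
  shows "(\<integral>\<^sup>+y. h ((1/2) *\<^sub>R x + (1/2) *\<^sub>R y) \<partial>lborel) = ennreal (2 ^ DIM('a)) * (\<integral>\<^sup>+y. h y \<partial>lborel)"
proof -
  have "(\<integral>\<^sup>+y. h y \<partial>lborel) = ennreal ((1/2) ^ DIM('a)) * (\<integral>\<^sup>+y. h ((1/2) *\<^sub>R x + (1/2) *\<^sub>R y) \<partial>lborel)"
    by (subst lborel_affine[of "1/2" "(1/2) *\<^sub>R x"])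
      (simp_all add: nn_integral_density nn_integral_distr nn_integral_cmult)
  then have "ennreal (2 ^ DIM('a)) * (\<integral>\<^sup>+y. h y \<partial>lborel)
      = (ennreal (2 ^ DIM('a)) * ennreal ((1/2) ^ DIM('a))) * (\<integral>\<^sup>+y. h ((1/2) *\<^sub>R x + (1/2) *\<^sub>R y) \<partial>lborel)"
    by (simp add: mult.assoc)
  also have "ennreal (2 ^ DIM('a)) * ennreal ((1/2) ^ DIM('a)) = 1"
    by (simp flip: ennreal_mult power_mult_distrib)
  finally show ?thesis by simp
qed

section \<open>Dyadic sums\<close>

text \<open>Follows from \<open>1 - exp (- t) \<le> t\<close> and \<open>ln 2 < 1\<close>. Taken at
  \<open>x = p * (1 - d)\<close>, it is the source of the factor \<open>1 - d\<close>.\<close>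

lemma one_minus_two_powr_le:
  fixes x :: real
  assumes "0 \<le> x"
  shows "1 - 2 powr (- x) \<le> x"
proof -
  have "ln 2 \<le> (1::real)" using ln_2_less_1 by simp
  then have "x * ln 2 \<le> x" using assms by (metis mult_left_mono mult.right_neutral)
  moreover have "1 + (- x * ln 2) \<le> exp (- x * ln 2)" by (rule exp_ge_add_one_self)
  ultimately show ?thesis by (simp add: powr_def)
qed

text \<open>The convex function \<open>2 powr (- x)\<close> lies below its chord
  \<open>1 - x / 2\<close> over [0, 1]. This bounds the geometric sum
  \<open>1 / (1 - 2 powr (- d))\<close> by \<open>2 / d\<close>.\<close>

lemma one_minus_two_powr_ge:
  fixes x :: real
  assumes "0 \<le> x" "x \<le> 1"
  shows "x / 2 \<le> 1 - 2 powr (- x)"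
proof -
  have "exp ((1 - x) *\<^sub>R 0 + x *\<^sub>R (- ln 2)) \<le> (1 - x) * exp 0 + x * exp (- ln (2::real))"
    using assms by (intro convex_onD[OF exp_convex]) auto
  then show ?thesis by (simp add: powr_def exp_minus field_simps)
qed

text \<open>As \<open>1 \<le> a\<close>, the terms at least double from one to the next, so the
  truncated sum is at most twice its last term.\<close>

lemma sum_two_powr_less:
  fixes a X :: real
  assumes "1 \<le> a" "0 < X"
  shows "(\<Sum>j<J. 2 powr (j * a) * indicator {..<X} (2 ^ j)) \<le> 2 * X powr a"
proof -
  let ?S = "\<lambda>J. \<Sum>j<J. 2 powr (j * a) * indicator {..<X} (2 ^ j) :: real"
  have two: "2 powr (J * a) = (2 ^ J) powr a" for J :: nat
    by (simp add: powr_powr flip: powr_realpow)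
  \<comment> \<open>The first bound feeds the induction: all earlier terms together do not exceed
    the new term \<open>2 powr (J * a)\<close>, which in turn is at most \<open>X powr a\<close>
    when \<open>2 ^ J < X\<close>.\<close>
  have "?S J \<le> 2 powr (J * a) \<and> ?S J \<le> 2 * X powr a"
  proof (induction J)
    case (Suc J)
    have "2 * 2 powr (J * a) \<le> 2 powr (Suc J * a)"
      using assms powr_mono[of 1 a "2::real"] by (simp add: algebra_simps powr_add)
    moreover have "2 powr (J * a) \<le> X powr a" if "2 ^ J < X"
      unfolding two using that assms by (intro powr_mono2) auto
    moreover have "0 \<le> 2 powr (J * a)" by simp
    moreover have "?S (Suc J) = ?S J + 2 powr (J * a) * indicator {..<X} (2 ^ J)"
      by (rule sum.lessThan_Suc)
    moreover have "2 powr (J * a) * indicator {..<X} (2 ^ J) = (if 2 ^ J < X then 2 powr (J * a) else 0)"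
      by simp
    ultimately show ?case using Suc by (smt (verit, best))
  qed simp
  then show ?thesis by simp
qed

text \<open>A geometric tail that starts at the first power of two beyond \<open>X\<close>; the
  factor \<open>1 - 2 powr (- d)\<close> makes it telescope.\<close>

lemma sum_two_powr_minus_ge:
  fixes d X :: real
  assumes "0 < d" "0 < X"
  shows "(\<Sum>j<J. 2 powr (- (j * d)) * indicator {X..} (2 ^ j)) * (1 - 2 powr (- d)) \<le> X powr (- d)"
proof -
  let ?S = "\<lambda>J. (\<Sum>j<J. 2 powr (- (j * d)) * indicator {X..} (2 ^ j)) * (1 - 2 powr (- d)) :: real"
  have two: "2 powr (- (J * d)) = (2 ^ J) powr (- d)" for J :: nat
    by (simp add: powr_powr flip: powr_realpow)
  \<comment> \<open>The maximum with 0 covers the \<open>J\<close> with \<open>2 ^ J < X\<close>,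
    for which the difference is negative and the sum still empty.\<close>
  have "?S J \<le> max 0 (X powr (- d) - 2 powr (- (J * d)))"
  proof (induction J)
    case (Suc J)
    have eq: "2 powr (- (Suc J * d)) = 2 powr (- (J * d)) * 2 powr (- d)"
      by (simp add: algebra_simps powr_diff powr_minus divide_simps flip: powr_add)
    show ?case
    proof (cases "X \<le> 2 ^ J")
      case True
      then have "2 powr (- (J * d)) \<le> X powr (- d)"
        unfolding two using assms by (intro powr_mono2') auto
      then have "?S J \<le> X powr (- d) - 2 powr (- (J * d))"
        using Suc.IH by simp
      then show ?thesis using True unfolding eq by (simp add: algebra_simps)
    next
      case False
      then have "X powr (- d) \<le> 2 powr (- (J * d))"
        unfolding two using assms by (intro powr_mono2') auto
      then have "?S J \<le> 0" using Suc.IH by (simp only: max_def) (smt (verit))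
      moreover have "?S (Suc J) = ?S J" using False by simp
      ultimately show ?thesis by linarith
    qed
  qed simp
  then show ?thesis by (smt (verit) powr_ge_zero)
qed

text \<open>The sum over all scales in the weak type estimate. Before the crossing
  \<open>2 ^ k * t = 1\<close> the terms grow like \<open>2 powr (k * (n - d))\<close>, where
  \<open>2 \<le> n\<close> and \<open>d < 1\<close> give an exponent of at least 1; after it they
  decay like \<open>2 powr (- (k * d))\<close>, which costs \<open>1 / d\<close>. Both parts are of
  the size \<open>t powr d\<close> of the crossing term.\<close>

lemma sum_two_powr_min_le:
  fixes d t :: real and n :: nat
  assumes d: "0 < d" "d < 1" and n: "2 \<le> n" and t: "0 \<le> t"
  shows "(\<Sum>k<J. 2 powr (- (k * d)) * min 1 ((2 ^ k * t) ^ n)) \<le> 4 / d * t powr d"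
proof (cases "t = 0")
  case True
  then show ?thesis using n by (auto simp: power_0_left)
next
  case False
  define X where "X = 1 / t"
  have X: "0 < X" "t = 1 / X" using t False by (auto simp: X_def)
  have pd: "2 powr (- (k * d)) * (2 ^ k * t) ^ n = t ^ n * 2 powr (k * (n - d))" for k :: nat
    by (simp add: power_mult_distrib algebra_simps powr_diff powr_minus divide_simps
        flip: powr_realpow powr_add powr_mult) (simp add: powr_powr flip: powr_realpow power_mult)
  have "(\<Sum>k<J. 2 powr (- (k * d)) * min 1 ((2 ^ k * t) ^ n))
      \<le> (\<Sum>k<J. t ^ n * (2 powr (k * (n - d)) * indicator {..<X} (2 ^ k))
           + 2 powr (- (k * d)) * indicator {X..} (2 ^ k))"
    by (intro sum_mono) (auto simp: indicator_def mult.assoc[symmetric] simp flip: pd intro!: mult_left_mono)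
  also have "\<dots> = t ^ n * (\<Sum>k<J. 2 powr (k * (n - d)) * indicator {..<X} (2 ^ k))
           + (\<Sum>k<J. 2 powr (- (k * d)) * indicator {X..} (2 ^ k))"
    by (simp only: sum.distrib sum_distrib_left)
  also have "\<dots> \<le> t ^ n * (2 * X powr (n - d)) + 2 / d * X powr (- d)"
  proof (intro add_mono mult_left_mono sum_two_powr_less)
    let ?s = "\<Sum>k<J. 2 powr (- (k * d)) * indicator {X..} (2 ^ k) :: real"
    have "?s * (d / 2) \<le> ?s * (1 - 2 powr (- d))"
      using d by (intro mult_left_mono one_minus_two_powr_ge sum_nonneg) auto
    also have "\<dots> \<le> X powr (- d)" by (rule sum_two_powr_minus_ge[OF d(1) X(1)])
    finally show "?s \<le> 2 / d * X powr (- d)" using d by (simp add: field_simps)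
  qed (use d n X t in auto)
  also have "t ^ n * (2 * X powr (n - d)) = 2 * t powr d"
    using X by (simp add: powr_diff powr_realpow powr_divide power_one_over)
  also have "2 / d * X powr (- d) = 2 / d * t powr d"
    using X by (simp add: powr_minus_divide powr_divide)
  also have "2 * t powr d \<le> 2 / d * t powr d"
    using d by (intro mult_right_mono) (auto simp: field_simps)
  finally show ?thesis by (simp add: field_simps)
qed

section \<open>Poincare inequality on a ball\<close>

text \<open>The midpoint \<open>m\<close> of a pair at distance below \<open>D\<close> lies in the
  convex set \<open>U\<close> and is at distance below \<open>D / 2\<close> from both points.
  Convexity of the power costs \<open>2 powr (p - 1)\<close>, the two halves cost 2, and the change
  of variables from \<open>y\<close> to \<open>m\<close> costs \<open>2 ^ DIM('a)\<close>.\<close>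

lemma nn_integral_close_pairs_halving:
  fixes f :: "'a::euclidean_space \<Rightarrow> real" and p :: real
  assumes [measurable]: "f \<in> borel_measurable borel" "U \<in> sets borel"
    and U: "convex U" and p: "1 \<le> p"
  defines "K \<equiv> \<lambda>D x y. ennreal (\<bar>f x - f y\<bar> powr p) * (indicator U x * indicator U y * indicator {..<D} (dist x y))"
  shows "(\<integral>\<^sup>+x. \<integral>\<^sup>+y. K D x y \<partial>lborel \<partial>lborel)
    \<le> ennreal (2 powr (p + DIM('a))) * (\<integral>\<^sup>+x. \<integral>\<^sup>+y. K (D / 2) x y \<partial>lborel \<partial>lborel)"
proof -
  have [measurable]: "(\<lambda>z. K D (fst z) (snd z)) \<in> borel_measurable (lborel \<Otimes>\<^sub>M lborel)" for D
    unfolding K_def by measurable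
  have [measurable]: "K D x \<in> borel_measurable borel" for D x
    unfolding K_def by measurable
  define m where "m x y = (1/2) *\<^sub>R x + (1/2) *\<^sub>R y" for x y :: 'a
  have [measurable]: "(\<lambda>z. m (fst z) (snd z)) \<in> borel_measurable (lborel \<Otimes>\<^sub>M lborel)" 
    "m x \<in> borel_measurable borel" for x
    unfolding m_def by measurable
  have [measurable]: "(\<lambda>z. K D (fst z) (m (fst z) (snd z))) \<in> borel_measurable (lborel \<Otimes>\<^sub>M lborel)"
    "(\<lambda>y. K D x (m x y)) \<in> borel_measurable borel" "(\<lambda>y. K D y (m x y)) \<in> borel_measurable borel" for D x
    unfolding K_def m_def by measurable
  have KM [measurable]: "(\<lambda>z. K D (snd z) (m (fst z) (snd z))) \<in> borel_measurable (lborel \<Otimes>\<^sub>M lborel)" for D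
    unfolding K_def m_def by measurable
  have sym: "K D x y = K D y x" for D x y
    by (simp add: K_def abs_minus_commute dist_commute mult.commute mult.left_commute)
  have msym: "m x y = m y x" for x y by (simp add: m_def add.commute)
  let ?c = "ennreal (2 powr (p - 1))"
  have le: "K D x y \<le> ?c * (K (D / 2) x (m x y) + K (D / 2) y (m x y))" for x y
  proof (cases "x \<in> U \<and> y \<in> U \<and> dist x y < D")
    case True
    have mU: "m x y \<in> U" unfolding m_def using True U by (intro convexD) auto
    have "x - m x y = (1/2) *\<^sub>R (x - y)" "y - m x y = (1/2) *\<^sub>R (y - x)"
      unfolding m_def by (simp_all add: algebra_simps flip: scaleR_add_left)
    then have d: "dist x (m x y) = dist x y / 2" "dist y (m x y) = dist x y / 2"
      by (simp_all add: dist_norm norm_minus_commute)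
    have "\<bar>f x - f y\<bar> powr p \<le> (\<bar>f x - f (m x y)\<bar> + \<bar>f y - f (m x y)\<bar>) powr p"
      using p by (intro powr_mono2) auto
    also have "\<dots> \<le> 2 powr (p - 1) * (\<bar>f x - f (m x y)\<bar> powr p + \<bar>f y - f (m x y)\<bar> powr p)"
      using p by (intro powr_sum_le) auto
    finally have "ennreal (\<bar>f x - f y\<bar> powr p)
        \<le> ?c * (ennreal (\<bar>f x - f (m x y)\<bar> powr p) + ennreal (\<bar>f y - f (m x y)\<bar> powr p))"
      by (simp flip: ennreal_mult ennreal_plus add: ennreal_leI)
    then show ?thesis using True mU d by (simp add: K_def)
  next
    case False
    then show ?thesis by (auto simp: K_def)
  qed
  have mid: "(\<integral>\<^sup>+y. K (D/2) x (m x y) \<partial>lborel) = ennreal (2 ^ DIM('a)) * (\<integral>\<^sup>+y. K (D/2) x y \<partial>lborel)" for x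
    unfolding m_def by (rule nn_integral_midpoint) measurable
  have mid2: "(\<integral>\<^sup>+x. \<integral>\<^sup>+y. K (D/2) x (m x y) \<partial>lborel \<partial>lborel)
      = ennreal (2 ^ DIM('a)) * (\<integral>\<^sup>+x. \<integral>\<^sup>+y. K (D/2) x y \<partial>lborel \<partial>lborel)" (is "?L = ?R")
    unfolding mid by (simp add: nn_integral_cmult)
  \<comment> \<open>The midpoint is symmetric in \<open>x\<close> and \<open>y\<close>, so
    exchanging the order of integration reduces the second half to the first.\<close>
  have swap: "(\<integral>\<^sup>+x. \<integral>\<^sup>+y. K (D/2) y (m x y) \<partial>lborel \<partial>lborel) = ?L"
    using KM lborel_pair.Fubini'[of "\<lambda>x y. K (D/2) y (m x y)"] by (simp add: msym split_beta')
  have "(\<integral>\<^sup>+x. \<integral>\<^sup>+y. K D x y \<partial>lborel \<partial>lborel)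
      \<le> (\<integral>\<^sup>+x. \<integral>\<^sup>+y. ?c * (K (D / 2) x (m x y) + K (D / 2) y (m x y)) \<partial>lborel \<partial>lborel)"
    by (intro nn_integral_mono le)
  also have "\<dots> = ?c * (?L + (\<integral>\<^sup>+x. \<integral>\<^sup>+y. K (D/2) y (m x y) \<partial>lborel \<partial>lborel))"
    by (simp add: nn_integral_cmult nn_integral_add)
  also have "\<dots> = ?c * (2 * ?R)"
    unfolding swap mid2 mult_2 ..
  also have "?c * (2 * ?R) = (?c * 2 * ennreal (2 ^ DIM('a))) * (\<integral>\<^sup>+x. \<integral>\<^sup>+y. K (D/2) x y \<partial>lborel \<partial>lborel)"
    by (simp add: mult.assoc)
  also have "?c * 2 * ennreal (2 ^ DIM('a)) = ennreal (2 powr (p - 1) * 2 * 2 ^ DIM('a))"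
    by (simp add: ennreal_mult)
  also have "2 powr (p - 1) * 2 * 2 ^ DIM('a) = 2 powr (p + DIM('a))"
    by (simp add: powr_add powr_diff powr_realpow)
  finally show ?thesis .
qed

text \<open>A Poincare inequality in double integral form with the Bourgain-Brezis-Mironescu factor
  \<open>1 - d\<close>. Halving is iterated \<open>j\<close> times; a weighted sum over all
  \<open>j\<close>, rather than one good \<open>j\<close>, gains this factor.\<close>

lemma BBM_pairs_le:
  fixes f :: "'a::euclidean_space \<Rightarrow> real" and p :: real
  assumes [measurable]: "f \<in> borel_measurable borel" "U \<in> sets borel"
    and U: "convex U" "\<And>x y. x \<in> U \<Longrightarrow> y \<in> U \<Longrightarrow> dist x y < R"
    and p: "1 \<le> p" and d: "0 < d" "d < 1" and R: "0 < R"
  defines "a \<equiv> DIM('a) + d * p"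
  shows "(\<integral>\<^sup>+x\<in>U. (\<integral>\<^sup>+y\<in>U. ennreal (\<bar>f x - f y\<bar> powr p) \<partial>lborel) \<partial>lborel)
    \<le> ennreal (2 * p * (1 - d) * R powr a) *
      (\<integral>\<^sup>+x\<in>U. (\<integral>\<^sup>+y\<in>U. ennreal (\<bar>f x - f y\<bar> powr p / norm (x - y) powr a) \<partial>lborel) \<partial>lborel)"
proof -
  define K where "K D x y = ennreal (\<bar>f x - f y\<bar> powr p) * (indicator U x * indicator U y * indicator {..<D} (dist x y))"
    for D x y
  have [measurable]: "(\<lambda>z. K D (fst z) (snd z)) \<in> borel_measurable (lborel \<Otimes>\<^sub>M lborel)" for D
    unfolding K_def by measurable
  have [measurable]: "K D x \<in> borel_measurable borel" for D x
    unfolding K_def by measurable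
  define A where "A D = (\<integral>\<^sup>+x. \<integral>\<^sup>+y. K D x y \<partial>lborel \<partial>lborel)" for D
  \<comment> \<open>The weights \<open>q ^ j\<close> of the scales: their sum \<open>1 / (1 - q)\<close> produces the factor \<open>1 - d\<close>.\<close>
  define q where "q = 2 powr (- (p * (1 - d)))"
  have pd: "0 < p * (1 - d)" using p d by simp
  have q: "0 < q" "q < 1" "1 - q \<le> p * (1 - d)"
    using pd one_minus_two_powr_le[of "p * (1 - d)"] unfolding q_def
    by (auto simp: powr_less_one)
  have a: "1 \<le> a" using d p by (simp add: a_def add_increasing2)
  have K0: "K D x = (\<lambda>_. 0)" if "x \<notin> U" for D x
    using that by (intro ext) (simp add: K_def)
  have AR: "A R = (\<integral>\<^sup>+x\<in>U. (\<integral>\<^sup>+y\<in>U. ennreal (\<bar>f x - f y\<bar> powr p) \<partial>lborel) \<partial>lborel)"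
    unfolding A_def nn_integral_multc[symmetric, OF borel_measurable_const]
    by (intro nn_integral_cong) (auto simp: K_def K0 U indicator_def intro!: nn_integral_cong)
  have halve: "A D \<le> ennreal (2 powr (p + DIM('a))) * A (D / 2)" for D
    unfolding A_def K_def by (rule nn_integral_close_pairs_halving) (use p in \<open>auto simp: U\<close>)
  have iter: "A R \<le> ennreal (2 powr (j * (p + DIM('a)))) * A (R / 2 ^ j)" for j :: nat
  proof (induction j)
    case (Suc j)
    have "A R \<le> ennreal (2 powr (j * (p + DIM('a)))) * (ennreal (2 powr (p + DIM('a))) * A (R / 2 ^ j / 2))"
      by (rule order_trans[OF Suc mult_left_mono[OF halve]]) simp
    also have "\<dots> = ennreal (2 powr (j * (p + DIM('a))) * 2 powr (p + DIM('a))) * A (R / 2 ^ j / 2)"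
      by (simp add: ennreal_mult mult.assoc)
    also have "2 powr (j * (p + DIM('a))) * 2 powr (p + DIM('a)) = (2::real) powr (Suc j * (p + DIM('a)))"
      by (simp flip: powr_add add: algebra_simps)
    finally show ?case by (simp add: mult.commute)
  qed simp
  \<comment> \<open>Multiplying by \<open>q ^ j\<close> lowers the exponent
    \<open>p + DIM('a)\<close> of the iterated halving to
    \<open>a = DIM('a) + d * p\<close>.\<close>
  have scale: "ennreal (q ^ j) * A R \<le> ennreal (2 powr (j * a)) * A (R / 2 ^ j)" for j :: nat
  proof -
    have "ennreal (q ^ j) * A R \<le> ennreal (q ^ j) * (ennreal (2 powr (j * (p + DIM('a)))) * A (R / 2 ^ j))"
      by (intro mult_left_mono iter) simp
    also have "\<dots> = ennreal (q ^ j * 2 powr (j * (p + DIM('a)))) * A (R / 2 ^ j)"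
      using q by (simp add: ennreal_mult mult.assoc)
    also have "q ^ j * 2 powr (j * (p + DIM('a))) = 2 powr (j * a)"
      by (simp add: q_def a_def powr_powr flip: powr_realpow powr_add) (simp add: algebra_simps)
    finally show ?thesis .
  qed
  \<comment> \<open>A pair is seen only by the scales with \<open>2 ^ j < R / norm (x - y)\<close>,
    so summing over \<open>j\<close> recovers the singular kernel. On the diagonal both sides vanish
    because \<open>f x - f y = 0\<close>.\<close>
  have pt: "(\<Sum>j. ennreal (2 powr (j * a)) * K (R / 2 ^ j) x y)
      \<le> ennreal (2 * R powr a) * (ennreal (\<bar>f x - f y\<bar> powr p / norm (x - y) powr a) * indicator U y * indicator U x)"
    for x y
  proof (cases "x \<in> U \<and> y \<in> U \<and> x \<noteq> y")
    case True
    define X where "X = R / norm (x - y)"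
    have X: "0 < X" "dist x y < R / 2 ^ j \<longleftrightarrow> 2 ^ j < X" for j :: nat
      using True R by (auto simp: X_def dist_norm field_simps)
    have "(\<Sum>j<J. ennreal (2 powr (j * a)) * K (R / 2 ^ j) x y)
        \<le> ennreal (2 * R powr a) * (ennreal (\<bar>f x - f y\<bar> powr p / norm (x - y) powr a))" for J
    proof -
      have "(\<Sum>j<J. ennreal (2 powr (j * a)) * K (R / 2 ^ j) x y)
          = (\<Sum>j<J. ennreal (2 powr (j * a) * indicator {..<X} (2 ^ j) * \<bar>f x - f y\<bar> powr p))"
        using True by (intro sum.cong) (auto simp: K_def indicator_def X ennreal_mult)
      also have "\<dots> = ennreal ((\<Sum>j<J. 2 powr (j * a) * indicator {..<X} (2 ^ j)) * \<bar>f x - f y\<bar> powr p)"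
        unfolding sum_distrib_right by (rule sum_ennreal) simp
      also have "\<dots> \<le> ennreal (2 * X powr a * \<bar>f x - f y\<bar> powr p)"
        by (intro ennreal_leI mult_right_mono sum_two_powr_less a X) simp
      also have "2 * X powr a * \<bar>f x - f y\<bar> powr p = 2 * R powr a * (\<bar>f x - f y\<bar> powr p / norm (x - y) powr a)"
        using R by (simp add: X_def powr_divide)
      finally show ?thesis by (subst ennreal_mult[symmetric]) simp_all
    qed
    then have "(\<Sum>j. ennreal (2 powr (j * a)) * K (R / 2 ^ j) x y)
        \<le> ennreal (2 * R powr a) * (ennreal (\<bar>f x - f y\<bar> powr p / norm (x - y) powr a))"
      by (intro suminf_le_const) auto
    then show ?thesis using True by simp
  next
    case False
    then have "K D x y = 0" for D by (auto simp: K_def)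
    then show ?thesis by simp
  qed
  let ?I = "\<integral>\<^sup>+x. \<integral>\<^sup>+y. ennreal (\<bar>f x - f y\<bar> powr p / norm (x - y) powr a) * indicator U y * indicator U x \<partial>lborel \<partial>lborel"
  have "ennreal (1 / (1 - q)) * A R = (\<Sum>j. ennreal (q ^ j) * A R)"
    using q suminf_geometric[of q] by (simp add: suminf_ennreal_eq[OF _ geometric_sums])
  also have "\<dots> \<le> (\<Sum>j. ennreal (2 powr (j * a)) * A (R / 2 ^ j))"
    by (intro suminf_le scale) auto
  also have "\<dots> = (\<integral>\<^sup>+x. \<integral>\<^sup>+y. (\<Sum>j. ennreal (2 powr (j * a)) * K (R / 2 ^ j) x y) \<partial>lborel \<partial>lborel)"
    by (simp add: A_def nn_integral_suminf nn_integral_cmult)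
  also have "\<dots> \<le> (\<integral>\<^sup>+x. \<integral>\<^sup>+y. ennreal (2 * R powr a) *
      (ennreal (\<bar>f x - f y\<bar> powr p / norm (x - y) powr a) * indicator U y * indicator U x) \<partial>lborel \<partial>lborel)"
    by (intro nn_integral_mono pt)
  also have "\<dots> = ennreal (2 * R powr a) * ?I"
    by (simp add: nn_integral_cmult)
  finally have "ennreal (1 - q) * (ennreal (1 / (1 - q)) * A R) \<le> ennreal (1 - q) * (ennreal (2 * R powr a) * ?I)"
    by (rule mult_left_mono) simp
  then have "A R \<le> ennreal (1 - q) * (ennreal (2 * R powr a) * ?I)"
    using q by (simp add: mult.assoc[symmetric] flip: ennreal_mult)
  also have "\<dots> \<le> ennreal (p * (1 - d)) * (ennreal (2 * R powr a) * ?I)"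
    using q by (intro mult_right_mono ennreal_leI) auto
  also have "\<dots> = ennreal (2 * p * (1 - d) * R powr a) * ?I"
    using pd by (simp add: mult.assoc[symmetric] flip: ennreal_mult) (simp add: mult_ac)
  also have "?I = (\<integral>\<^sup>+x\<in>U. (\<integral>\<^sup>+y\<in>U. ennreal (\<bar>f x - f y\<bar> powr p / norm (x - y) powr a) \<partial>lborel) \<partial>lborel)"
    by (simp add: nn_integral_multc)
  finally show ?thesis unfolding AR .
qed

section \<open>Pointwise bound by a dyadic potential\<close>

text \<open>The counterpart of \<open>avg\<close> for \<open>lborel\<close>. The estimates are
  proved for Borel functions, where Fubini's theorem applies directly, and transferred to Lebesgue
  measurable functions at the end.\<close>

definition lavg :: "('a::euclidean_space \<Rightarrow> real) \<Rightarrow> 'a set \<Rightarrow> real" where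
  "lavg f S = (LINT x:S|lborel. f x) / measure lborel S"

text \<open>The \<open>p\<close>-th power of the fractional gradient relative to \<open>S\<close>;
  the exponent is always \<open>a = DIM('a) + d * p\<close>. At \<open>y = x\<close> the quotient is
  \<open>0 / 0 = 0\<close>.\<close>

definition frac_grad :: "real \<Rightarrow> real \<Rightarrow> ('a::euclidean_space \<Rightarrow> real) \<Rightarrow> 'a set \<Rightarrow> 'a \<Rightarrow> ennreal" where
  "frac_grad a p f S x = (\<integral>\<^sup>+y\<in>S. ennreal (\<bar>f x - f y\<bar> powr p / norm (x - y) powr a) \<partial>lborel)"

lemma borel_measurable_frac_grad [measurable]:
  assumes [measurable]: "f \<in> borel_measurable borel" "S \<in> sets borel"
  shows "frac_grad a p f S \<in> borel_measurable borel"
  unfolding frac_grad_def by measurable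

lemma frac_grad_mono: "S \<subseteq> T \<Longrightarrow> frac_grad a p f S x \<le> frac_grad a p f T x"
  unfolding frac_grad_def by (intro nn_integral_mono) (auto simp: indicator_def)

lemma ennreal_divide_real: "0 < b \<Longrightarrow> x / ennreal b = ennreal (1 / b) * x"
  by (simp add: divide_ennreal_def inverse_ennreal inverse_eq_divide mult.commute)

text \<open>\<open>le_young_powr\<close> averaged over \<open>S\<close>. Leaving \<open>t\<close>
  free avoids a \<open>p\<close>-th root in [0, \<infinity>]; it is later matched to a power of the
  radius.\<close>

lemma abs_diff_lavg_le_powr:
  fixes f :: "'a::euclidean_space \<Rightarrow> real"
  assumes [measurable]: "f \<in> borel_measurable borel" "S \<in> sets borel"
    and f: "set_integrable lborel S f" and S: "emeasure lborel S = ennreal b" "0 < b"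
    and p: "1 \<le> p" and t: "0 < t"
  shows "ennreal \<bar>c - lavg f S\<bar>
    \<le> ennreal t + ennreal (t powr (1 - p) / b) * (\<integral>\<^sup>+x\<in>S. ennreal (\<bar>c - f x\<bar> powr p) \<partial>lborel)"
proof -
  have "ennreal \<bar>c - lavg f S\<bar> \<le> ennreal (1 / b) * (\<integral>\<^sup>+x\<in>S. ennreal \<bar>c - f x\<bar> \<partial>lborel)"
    using abs_diff_avg_le[of S f c] f S by (simp add: lavg_def ennreal_divide_real)
  also have "\<dots> \<le> ennreal (1 / b) *
      (\<integral>\<^sup>+x. ennreal (t powr (1 - p)) * (ennreal (\<bar>c - f x\<bar> powr p) * indicator S x) + ennreal t * indicator S x \<partial>lborel)"
  proof (intro mult_left_mono nn_integral_mono)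
    show "ennreal \<bar>c - f x\<bar> * indicator S x \<le>
        ennreal (t powr (1 - p)) * (ennreal (\<bar>c - f x\<bar> powr p) * indicator S x) + ennreal t * indicator S x" for x
      using ennreal_leI[OF le_young_powr[OF t abs_ge_zero p, of "c - f x"]] t
      by (auto simp: indicator_def ennreal_mult)
  qed simp
  also have "\<dots> = ennreal (1 / b) * (ennreal (t powr (1 - p)) * (\<integral>\<^sup>+x\<in>S. ennreal (\<bar>c - f x\<bar> powr p) \<partial>lborel) + ennreal t * ennreal b)"
    by (simp add: nn_integral_add nn_integral_cmult S)
  also have "\<dots> = (ennreal (1 / b) * ennreal (t powr (1 - p))) * (\<integral>\<^sup>+x\<in>S. ennreal (\<bar>c - f x\<bar> powr p) \<partial>lborel)
      + ennreal (1 / b) * (ennreal t * ennreal b)"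
    by (simp add: distrib_left mult.assoc)
  also have "ennreal (1 / b) * (ennreal t * ennreal b) = ennreal t"
    using S t by (simp flip: ennreal_mult)
  also have "ennreal (1 / b) * ennreal (t powr (1 - p)) = ennreal (t powr (1 - p) / b)"
    using S t by (simp flip: ennreal_mult)
  finally show ?thesis by (simp add: add.commute)
qed

text \<open>First \<open>lavg f S\<close> is compared with \<open>f x\<close> on average over
  \<open>x\<close> in \<open>T\<close>, then each \<open>f x\<close> with \<open>lavg f S\<close> by
  the preceding bound. The parameter \<open>t\<close> passes through both averages
  unchanged.\<close>

lemma abs_diff_lavg_lavg_le_powr:
  fixes f :: "'a::euclidean_space \<Rightarrow> real"
  assumes [measurable]: "f \<in> borel_measurable borel" "S \<in> sets borel" "T \<in> sets borel"
    and f: "set_integrable lborel S f" "set_integrable lborel T f"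
    and S: "emeasure lborel S = ennreal b" "0 < b" and T: "emeasure lborel T = ennreal b'" "0 < b'"
    and p: "1 \<le> p" and t: "0 < t"
  shows "ennreal \<bar>lavg f T - lavg f S\<bar>
    \<le> ennreal t + ennreal (t powr (1 - p) / (b * b')) *
      (\<integral>\<^sup>+x\<in>T. (\<integral>\<^sup>+y\<in>S. ennreal (\<bar>f x - f y\<bar> powr p) \<partial>lborel) \<partial>lborel)"
proof -
  let ?H = "\<lambda>x. \<integral>\<^sup>+y\<in>S. ennreal (\<bar>f x - f y\<bar> powr p) \<partial>lborel"
  have "ennreal \<bar>lavg f S - lavg f T\<bar> \<le> ennreal (1 / b') * (\<integral>\<^sup>+x\<in>T. ennreal \<bar>lavg f S - f x\<bar> \<partial>lborel)"
    using abs_diff_avg_le[of T f "lavg f S"] f T by (simp add: lavg_def ennreal_divide_real)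
  also have "\<dots> \<le> ennreal (1 / b') *
      (\<integral>\<^sup>+x. ennreal t * indicator T x + ennreal (t powr (1 - p) / b) * (?H x * indicator T x) \<partial>lborel)"
  proof (intro mult_left_mono nn_integral_mono)
    show "ennreal \<bar>lavg f S - f x\<bar> * indicator T x \<le>
        ennreal t * indicator T x + ennreal (t powr (1 - p) / b) * (?H x * indicator T x)" for x
      using abs_diff_lavg_le_powr[OF assms(1,2) f(1) S p t, of "f x"]
      by (auto simp: indicator_def abs_minus_commute)
  qed simp
  also have "\<dots> = ennreal (1 / b') * (ennreal t * ennreal b' + ennreal (t powr (1 - p) / b) * (\<integral>\<^sup>+x\<in>T. ?H x \<partial>lborel))"
    by (simp add: nn_integral_add nn_integral_cmult T)
  also have "\<dots> = ennreal (1 / b') * (ennreal t * ennreal b')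
      + (ennreal (1 / b') * ennreal (t powr (1 - p) / b)) * (\<integral>\<^sup>+x\<in>T. ?H x \<partial>lborel)"
    by (simp add: distrib_left mult.assoc)
  also have "ennreal (1 / b') * (ennreal t * ennreal b') = ennreal t"
    using T t by (simp flip: ennreal_mult)
  also have "ennreal (1 / b') * ennreal (t powr (1 - p) / b) = ennreal (t powr (1 - p) / (b * b'))"
    using S T t by (simp flip: ennreal_mult add: mult.commute)
  finally show ?thesis by (simp add: abs_minus_commute)
qed

text \<open>The averages over the shrinking balls \<open>U k\<close> telescope from
  \<open>lavg f (ball z r)\<close> to \<open>f x\<close>. Finiteness of the fractional gradient at
  \<open>x\<close> gives the convergence, in place of Lebesgue's differentiation theorem. The
  parameter \<open>s\<close> balances the two terms and is chosen in the weak type estimate.\<close>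

lemma abs_diff_lavg_le_riesz:
  fixes f :: "'a::euclidean_space \<Rightarrow> real" and p d r s :: real
  assumes [measurable]: "f \<in> borel_measurable borel"
    and f: "set_integrable lborel (ball z r) f"
    and p: "1 \<le> p" and d: "0 < d" "d < 1" and r: "0 < r" and s: "0 < s"
    and x: "x \<in> ball z r"
  defines "a \<equiv> DIM('a) + d * p" and "V \<equiv> unit_ball_vol DIM('a)"
  assumes G: "frac_grad a p f (ball z r) x < \<infinity>"
  shows "ennreal \<bar>f x - lavg f (ball z r)\<bar>
    \<le> ennreal (s * (2 / d * r powr d)) +
      ennreal (s powr (1 - p) * (2 powr (2 * DIM('a) + 1 + d * p) / V\<^sup>2 * p * (1 - d))) *
      (\<Sum>k. ennreal ((r / 2 ^ k) powr (d - DIM('a))) *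
         (\<integral>\<^sup>+u\<in>ball z r \<inter> ball x (2 * (r / 2 ^ k)). frac_grad a p f (ball z r) u \<partial>lborel))"
proof -
  define B where "B = ball z r"
  define n where "n = real DIM('a)"
  define \<rho> where "\<rho> k = r / 2 ^ k" for k :: nat
  define U where "U k = ball (x + (1 / 2 ^ k) *\<^sub>R (z - x)) (\<rho> k)" for k
  define C where "C = 2 powr (2 * n + 1 + d * p) / V\<^sup>2 * p * (1 - d)"
  define J where "J k = (\<integral>\<^sup>+u\<in>B \<inter> ball x (2 * \<rho> k). frac_grad a p f B u \<partial>lborel)" for k
  have V: "0 < V" by (simp add: V_def)
  have \<rho>: "0 < \<rho> k" for k using r by (simp add: \<rho>_def)
  have C: "0 \<le> C" using p d by (simp add: C_def)
  have Usub: "U k \<subseteq> B" for k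
  proof
    fix y assume y: "y \<in> U k"
    define l :: real where "l = 1 / 2 ^ k"
    have l: "0 < l" "l \<le> 1" by (auto simp: l_def)
    have "norm (z - y) \<le> norm ((1 - l) *\<^sub>R (z - x)) + norm (x + l *\<^sub>R (z - x) - y)"
      by (rule order_trans[OF _ norm_triangle_ineq]) (simp add: algebra_simps)
    also have "norm ((1 - l) *\<^sub>R (z - x)) \<le> (1 - l) * r"
      using x l by (auto simp: dist_norm intro!: mult_left_mono)
    also have "norm (x + l *\<^sub>R (z - x) - y) < l * r"
      using y by (simp add: U_def \<rho>_def l_def dist_norm)
    finally show "y \<in> B" by (simp add: B_def dist_norm algebra_simps)
  qed
  have Ux: "U k \<subseteq> ball x (2 * \<rho> k)" for k
  proof
    fix y assume y: "y \<in> U k"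
    have "norm (x - y) \<le> norm ((1 / 2 ^ k) *\<^sub>R (x - z)) + norm (x + (1 / 2 ^ k) *\<^sub>R (z - x) - y)"
      by (rule order_trans[OF _ norm_triangle_ineq]) (simp add: algebra_simps)
    also have "norm ((1 / 2 ^ k) *\<^sub>R (x - z)) \<le> \<rho> k"
      using x by (auto simp: \<rho>_def dist_norm norm_minus_commute intro!: divide_right_mono)
    also have "norm (x + (1 / 2 ^ k) *\<^sub>R (z - x) - y) < \<rho> k"
      using y by (simp add: U_def dist_norm)
    finally show "y \<in> ball x (2 * \<rho> k)" by (simp add: dist_norm)
  qed
  have [measurable]: "U k \<in> sets borel" "B \<in> sets borel" for k by (simp_all add: U_def B_def)
  have Uint: "set_integrable lborel (U k) f" for k
    by (rule set_integrable_subset[OF f]) (use Usub in \<open>auto simp: B_def\<close>)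
  have Uvol: "emeasure lborel (U k) = ennreal (V * \<rho> k powr n)" "0 < V * \<rho> k powr n" for k
    using \<rho>[of k] V by (simp_all add: U_def emeasure_ball V_def n_def powr_realpow)
  have step: "ennreal \<bar>lavg f (U (Suc k)) - lavg f (U k)\<bar>
      \<le> ennreal (s * \<rho> k powr d) + ennreal (s powr (1 - p) * C) * (ennreal (\<rho> k powr (d - n)) * J k)" for k
  proof -
    \<comment> \<open>With this choice the first terms form a geometric series in \<open>k\<close>,
      and the radius in the second has the exponent
      \<open>d * (1 - p) - 2 * n + (n + d * p) = d - n\<close> of a Riesz potential of order
      \<open>d\<close>.\<close>
    let ?t = "s * \<rho> k powr d"
    let ?b = "V * \<rho> k powr n" and ?b' = "V * \<rho> (Suc k) powr n"
    have sub: "U (Suc k) \<subseteq> U k"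
    proof
      fix y assume y: "y \<in> U (Suc k)"
      have "norm (x + (1 / 2 ^ k) *\<^sub>R (z - x) - y) \<le>
          norm ((1 / 2 ^ Suc k) *\<^sub>R (z - x)) + norm (x + (1 / 2 ^ Suc k) *\<^sub>R (z - x) - y)"
        by (rule order_trans[OF _ norm_triangle_ineq]) (simp add: algebra_simps flip: scaleR_add_left)
      also have "norm ((1 / 2 ^ Suc k) *\<^sub>R (z - x)) \<le> \<rho> (Suc k)"
        using x by (auto simp: \<rho>_def dist_norm intro!: divide_right_mono)
      also have "norm (x + (1 / 2 ^ Suc k) *\<^sub>R (z - x) - y) < \<rho> (Suc k)"
        using y by (simp add: U_def dist_norm)
      finally show "y \<in> U k" by (simp add: U_def \<rho>_def dist_norm)
    qed
    let ?II = "\<integral>\<^sup>+x\<in>U k. (\<integral>\<^sup>+y\<in>U k. ennreal (\<bar>f x - f y\<bar> powr p) \<partial>lborel) \<partial>lborel"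
    have "ennreal \<bar>lavg f (U (Suc k)) - lavg f (U k)\<bar> \<le> ennreal ?t + ennreal (?t powr (1 - p) / (?b * ?b')) *
        (\<integral>\<^sup>+x\<in>U (Suc k). (\<integral>\<^sup>+y\<in>U k. ennreal (\<bar>f x - f y\<bar> powr p) \<partial>lborel) \<partial>lborel)"
      using s \<rho>[of k] by (intro abs_diff_lavg_lavg_le_powr Uint Uvol p) auto
    also have "\<dots> \<le> ennreal ?t + ennreal (?t powr (1 - p) / (?b * ?b')) * ?II"
      using sub by (intro add_left_mono mult_left_mono nn_integral_mono) (auto simp: indicator_def)
    also have "?II \<le> ennreal (2 * p * (1 - d) * (2 * \<rho> k) powr a) *
        (\<integral>\<^sup>+x\<in>U k. (\<integral>\<^sup>+y\<in>U k. ennreal (\<bar>f x - f y\<bar> powr p / norm (x - y) powr a) \<partial>lborel) \<partial>lborel)"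
      unfolding a_def
    proof (rule BBM_pairs_le)
      fix u v assume uv: "u \<in> U k" "v \<in> U k"
      show "dist u v < 2 * \<rho> k"
        using uv dist_triangle_less_add[of u "x + (1 / 2 ^ k) *\<^sub>R (z - x)" "\<rho> k" v "\<rho> k"]
        by (simp add: U_def dist_commute)
    qed (use p d \<rho>[of k] in \<open>auto simp: U_def\<close>)
    also have "(\<integral>\<^sup>+x\<in>U k. (\<integral>\<^sup>+y\<in>U k. ennreal (\<bar>f x - f y\<bar> powr p / norm (x - y) powr a) \<partial>lborel) \<partial>lborel) \<le> J k"
      unfolding J_def frac_grad_def[symmetric] using Usub[of k] Ux[of k]
      by (intro nn_integral_mono mult_mono frac_grad_mono) (auto simp: indicator_def)
    also have "ennreal (?t powr (1 - p) / (?b * ?b')) * (ennreal (2 * p * (1 - d) * (2 * \<rho> k) powr a) * J k)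
        = ennreal (?t powr (1 - p) / (?b * ?b') * (2 * p * (1 - d) * (2 * \<rho> k) powr a)) * J k"
      using s V p d by (subst ennreal_mult) (auto simp: mult.assoc)
    also have "?t powr (1 - p) / (?b * ?b') * (2 * p * (1 - d) * (2 * \<rho> k) powr a)
        = s powr (1 - p) * C * \<rho> k powr (d - n)"
    proof -
      have e1: "?t powr (1 - p) = s powr (1 - p) * \<rho> k powr (d * (1 - p))"
        using s \<rho>[of k] by (simp add: powr_mult powr_powr)
      have e2: "\<rho> (Suc k) powr n = \<rho> k powr n * 2 powr (- n)"
        using \<rho>[of k] by (simp add: \<rho>_def powr_divide powr_minus_divide powr_mult)
      have e3: "(2 * \<rho> k) powr a = 2 powr (n + d * p) * \<rho> k powr (n + d * p)"
        using \<rho>[of k] by (simp add: powr_mult a_def n_def)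
      have e4: "\<rho> k powr (d * (1 - p)) * \<rho> k powr (n + d * p) = \<rho> k powr (d - n) * (\<rho> k powr n * \<rho> k powr n)"
        by (simp flip: powr_add add: algebra_simps)
      \<comment> \<open>The powers of two come from the diameter bound \<open>2 * \<rho> k\<close>,
        from the factor 2 in \<open>BBM_pairs_le\<close>, and from the volume ratio of
        \<open>U k\<close> and \<open>U (Suc k)\<close>.\<close>
      have e5: "2 powr (2 * n + 1 + d * p) = 2 powr (n + d * p) * (2 * 2 powr n)"
        using powr_add[of 2 1 "2 * n + d * p"] by (simp flip: powr_add add: algebra_simps)
      have "?t powr (1 - p) / (?b * ?b') * (2 * p * (1 - d) * (2 * \<rho> k) powr a)
          = s powr (1 - p) * (\<rho> k powr (d * (1 - p)) * \<rho> k powr (n + d * p)) / (\<rho> k powr n * \<rho> k powr n)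
            * (2 powr (n + d * p) * (2 * 2 powr n)) / V\<^sup>2 * p * (1 - d)"
        unfolding e1 e2 e3 by (simp add: powr_minus power2_eq_square field_simps)
      also have "\<dots> = s powr (1 - p) * C * \<rho> k powr (d - n)"
        unfolding e4 C_def e5 using \<rho>[of k] by simp
      finally show ?thesis .
    qed
    also have "ennreal (s powr (1 - p) * C * \<rho> k powr (d - n)) * J k
        = ennreal (s powr (1 - p) * C) * (ennreal (\<rho> k powr (d - n)) * J k)"
      using C by (subst ennreal_mult) (auto simp: mult.assoc)
    finally show ?thesis by (simp add: add_left_mono mult_left_mono)
  qed
  define D where "D k = ennreal (s * \<rho> k powr d) + ennreal (s powr (1 - p) * C) * (ennreal (\<rho> k powr (d - n)) * J k)" for k
  have tele: "ennreal \<bar>lavg f (U K) - lavg f B\<bar> \<le> (\<Sum>k<K. D k)" for K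
  proof (induction K)
    case 0
    then show ?case by (simp add: U_def B_def \<rho>_def)
  next
    case (Suc K)
    have "\<bar>lavg f (U (Suc K)) - lavg f B\<bar> \<le> \<bar>lavg f (U K) - lavg f B\<bar> + \<bar>lavg f (U (Suc K)) - lavg f (U K)\<bar>"
      by simp
    then have "ennreal \<bar>lavg f (U (Suc K)) - lavg f B\<bar>
        \<le> ennreal \<bar>lavg f (U K) - lavg f B\<bar> + ennreal \<bar>lavg f (U (Suc K)) - lavg f (U K)\<bar>"
      by (simp flip: ennreal_plus add: ennreal_leI)
    also have "\<dots> \<le> (\<Sum>k<K. D k) + D K"
      using Suc step[of K] by (intro add_mono) (auto simp: D_def)
    finally show ?case by simp
  qed
  obtain g where g: "frac_grad a p f B x = ennreal g" "0 \<le> g"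
    using G by (cases "frac_grad a p f B x") (auto simp: B_def)
  \<comment> \<open>On \<open>U k\<close> the distance to \<open>x\<close> is at most
    \<open>2 * \<rho> k\<close>, so the finite value \<open>g\<close> controls the mean oscillation
    around \<open>f x\<close>; the bound tends to 0 like \<open>\<rho> k powr d\<close>.\<close>
  have lim: "ennreal \<bar>f x - lavg f (U k)\<bar> \<le> ennreal (\<rho> k powr d * (1 + 2 powr a / V * g))" for k
  proof -
    let ?t = "\<rho> k powr d"
    have "ennreal \<bar>f x - lavg f (U k)\<bar> \<le> ennreal ?t + ennreal (?t powr (1 - p) / (V * \<rho> k powr n)) *
        (\<integral>\<^sup>+y\<in>U k. ennreal (\<bar>f x - f y\<bar> powr p) \<partial>lborel)"
      using \<rho>[of k] by (intro abs_diff_lavg_le_powr Uint Uvol p) auto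
    also have "(\<integral>\<^sup>+y\<in>U k. ennreal (\<bar>f x - f y\<bar> powr p) \<partial>lborel) \<le>
        (\<integral>\<^sup>+y. ennreal ((2 * \<rho> k) powr a) * (ennreal (\<bar>f x - f y\<bar> powr p / norm (x - y) powr a) * indicator B y) \<partial>lborel)"
    proof (intro nn_integral_mono)
      fix y
      show "ennreal (\<bar>f x - f y\<bar> powr p) * indicator (U k) y \<le>
          ennreal ((2 * \<rho> k) powr a) * (ennreal (\<bar>f x - f y\<bar> powr p / norm (x - y) powr a) * indicator B y)"
      proof (cases "y \<in> U k \<and> x \<noteq> y")
        case True
        then have "norm (x - y) \<le> 2 * \<rho> k" using Ux[of k] by (auto simp: dist_norm subset_iff)
        then have "norm (x - y) powr a \<le> (2 * \<rho> k) powr a"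
          using d p by (intro powr_mono2) (auto simp: a_def)
        then have "\<bar>f x - f y\<bar> powr p * norm (x - y) powr a \<le> (2 * \<rho> k) powr a * \<bar>f x - f y\<bar> powr p"
          by (subst mult.commute) (intro mult_right_mono, auto)
        then have "\<bar>f x - f y\<bar> powr p \<le> (2 * \<rho> k) powr a * (\<bar>f x - f y\<bar> powr p / norm (x - y) powr a)"
          using True by (simp add: field_simps)
        then show ?thesis using True Usub[of k] by (auto simp: indicator_def simp flip: ennreal_mult intro!: ennreal_leI)
      qed auto
    qed
    also have "\<dots> = ennreal ((2 * \<rho> k) powr a) * ennreal g"
      unfolding g(1)[symmetric] frac_grad_def by (intro nn_integral_cmult) measurable
    also have "ennreal ?t + ennreal (?t powr (1 - p) / (V * \<rho> k powr n)) * (ennreal ((2 * \<rho> k) powr a) * ennreal g)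
        = ennreal (?t + ?t powr (1 - p) / (V * \<rho> k powr n) * ((2 * \<rho> k) powr a * g))"
      using g V by (simp flip: ennreal_mult ennreal_plus)
    also have "?t + ?t powr (1 - p) / (V * \<rho> k powr n) * ((2 * \<rho> k) powr a * g) = \<rho> k powr d * (1 + 2 powr a / V * g)"
    proof -
      have e: "\<rho> k powr (d * (1 - p)) * \<rho> k powr a = \<rho> k powr d * \<rho> k powr n"
        by (simp flip: powr_add add: algebra_simps a_def n_def)
      have "?t powr (1 - p) / (V * \<rho> k powr n) * ((2 * \<rho> k) powr a * g)
          = (\<rho> k powr (d * (1 - p)) * \<rho> k powr a) / \<rho> k powr n * (2 powr a / V * g)"
        using \<rho>[of k] by (simp add: powr_powr powr_mult mult_ac)
      then show ?thesis unfolding e using \<rho>[of k] by (simp add: algebra_simps)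
    qed
    finally show ?thesis by (simp add: add_left_mono mult_left_mono)
  qed
  have rho_geo: "\<rho> k powr d = r powr d * (2 powr (- d)) ^ k" for k
    using r by (simp add: \<rho>_def powr_divide powr_powr powr_minus_divide power_one_over mult.commute flip: powr_realpow)
  have q: "0 < 2 powr (- d)" "2 powr (- d) < (1::real)" using d by (auto simp: powr_less_one)
  have "(\<lambda>k. \<rho> k powr d * (1 + 2 powr a / V * g)) \<longlonglongrightarrow> r powr d * 0 * (1 + 2 powr a / V * g)"
    unfolding rho_geo using q by (intro tendsto_intros) auto
  then have "(\<lambda>k. ennreal (\<rho> k powr d * (1 + 2 powr a / V * g)) + (\<Sum>k. D k)) \<longlonglongrightarrow> ennreal 0 + (\<Sum>k. D k)"
    by (intro tendsto_add tendsto_ennrealI tendsto_const) simp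
  moreover have "ennreal \<bar>f x - lavg f B\<bar> \<le> ennreal (\<rho> k powr d * (1 + 2 powr a / V * g)) + (\<Sum>k. D k)" for k
  proof -
    have "ennreal \<bar>f x - lavg f B\<bar> \<le> ennreal (\<bar>f x - lavg f (U k)\<bar> + \<bar>lavg f (U k) - lavg f B\<bar>)"
      by (intro ennreal_leI) simp
    also have "\<dots> = ennreal \<bar>f x - lavg f (U k)\<bar> + ennreal \<bar>lavg f (U k) - lavg f B\<bar>"
      by simp
    also have "\<dots> \<le> ennreal (\<rho> k powr d * (1 + 2 powr a / V * g)) + (\<Sum>k. D k)"
      by (intro add_mono lim order_trans[OF tele] sum_le_suminf) auto
    finally show ?thesis .
  qed
  ultimately have "ennreal \<bar>f x - lavg f B\<bar> \<le> ennreal 0 + (\<Sum>k. D k)"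
    by (intro LIMSEQ_le_const) auto
  also have "ennreal 0 + (\<Sum>k. D k) = (\<Sum>k. ennreal (s * \<rho> k powr d)) +
      ennreal (s powr (1 - p) * C) * (\<Sum>k. ennreal (\<rho> k powr (d - n)) * J k)"
    unfolding D_def by (simp add: suminf_add[symmetric])
  also have "(\<Sum>k. ennreal (s * \<rho> k powr d)) = ennreal (s * r powr d * (1 / (1 - 2 powr (- d))))"
    using sums_mult[OF geometric_sums[of "2 powr (- d)"], of "s * r powr d"] s q
    by (intro suminf_ennreal_eq) (auto simp: rho_geo mult.assoc)
  also have "\<dots> \<le> ennreal (s * (2 / d * r powr d))"
  proof (rule ennreal_leI)
    have "1 / (1 - 2 powr (- d)) \<le> 1 / (d / 2)"
      using one_minus_two_powr_ge[of d] d q by (intro divide_left_mono) auto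
    then have "s * r powr d * (1 / (1 - 2 powr (- d))) \<le> s * r powr d * (1 / (d / 2))"
      using s by (intro mult_left_mono) auto
    then show "s * r powr d * (1 / (1 - 2 powr (- d))) \<le> s * (2 / d * r powr d)"
      by (simp add: field_simps)
  qed
  finally show ?thesis by (simp add: B_def C_def J_def n_def \<rho>_def add_ac)
qed

section \<open>Weak type estimate\<close>

text \<open>Its \<open>p\<close>-th power has to absorb the constant of the weak type estimate,
  since a \<open>p\<close>-th root is taken at the end. The maximum keeps the base at least 1, so
  that raising it to the power \<open>p\<close> only enlarges it.\<close>

definition frac_const :: "nat \<Rightarrow> real" where
  "frac_const n = 2 ^ (3 * n + 7) * max 1 (1 / unit_ball_vol n)"

lemma frac_const_ge_1: "1 \<le> frac_const n"
proof -
  have "(1::real) * 1 \<le> 2 ^ (3 * n + 7) * max 1 (1 / unit_ball_vol n)"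
    by (intro mult_mono) auto
  then show ?thesis by (simp add: frac_const_def)
qed

text \<open>The left side is the product of the constants met in the weak type estimate. All powers
  of \<open>d\<close> on the left combine to \<open>1 / d powr p\<close>, and the powers of
  \<open>r\<close> to \<open>r powr (d * p)\<close>.\<close>

lemma weak_const_le_frac_const:
  fixes p d r :: real and n :: nat
  assumes p: "1 \<le> p" and d: "0 < d" "d < 1" and r: "0 < r"
  defines "V \<equiv> unit_ball_vol n"
  shows "2 powr p * (2 / d * r powr d) powr (p - 1) * (2 powr (2 * n + 1 + d * p) / V\<^sup>2 * p) * (4 / d * (2 ^ n * V * r powr d))
    \<le> frac_const n powr p * r powr (d * p) / d powr p"
proof -
  have V: "0 < V" by (simp add: V_def)
  have e1: "(2 / d * r powr d) powr (p - 1) = 2 powr (p - 1) * r powr (d * p) / (r powr d * d powr p) * d"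
    using d r by (simp add: powr_mult powr_divide powr_diff powr_powr field_simps)
  have "2 powr p * (2 / d * r powr d) powr (p - 1) * (2 powr (2 * n + 1 + d * p) / V\<^sup>2 * p) * (4 / d * (2 ^ n * V * r powr d))
      = (2 powr p * 2 powr (p - 1) * 2 powr (2 * n + 1 + d * p) * (2 powr 2 * 2 powr n) * p * (1 / V)) * r powr (d * p) / d powr p"
    unfolding e1 using d r V by (simp add: powr_realpow power2_eq_square field_simps)
  also have "\<dots> \<le> frac_const n powr p * r powr (d * p) / d powr p"
  proof (intro divide_right_mono mult_right_mono)
    \<comment> \<open>The lone factor \<open>p\<close> is traded for \<open>2 powr (p + 1)\<close>,
      which a \<open>p\<close>-th power can absorb.\<close>
    have "1 + p * ln 2 \<le> exp (p * ln 2)" by (rule exp_ge_add_one_self)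
    moreover have "p / 2 \<le> p * ln 2" using p ln2_ge_two_thirds by (simp add: field_simps)
    moreover have "2 powr p = exp (p * ln 2)" by (simp add: powr_def)
    ultimately have "p / 2 \<le> 2 powr p" by linarith
    then have p2: "p \<le> 2 powr (p + 1)" by (simp add: powr_add)
    have "2 powr p * 2 powr (p - 1) * 2 powr (2 * n + 1 + d * p) * (2 powr 2 * 2 powr n) * p * (1 / V)
        \<le> 2 powr p * 2 powr (p - 1) * 2 powr (2 * n + 1 + d * p) * (2 powr 2 * 2 powr n) * 2 powr (p + 1) * max 1 (1 / V)"
      using p V p2 by (intro mult_mono) auto
    also have "\<dots> = 2 powr (3 * p + d * p + (3 * n + 3)) * max 1 (1 / V)"
      by (simp only: powr_add[symmetric]) (simp add: algebra_simps)
    also have "\<dots> \<le> 2 powr ((3 * n + 7) * p) * max 1 (1 / V) powr p"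
    proof (intro mult_mono powr_mono)
      have "d * p \<le> p" using p d by simp
      moreover have "real (3 * n + 3) \<le> (3 * n + 3) * p"
        using p by (simp add: mult_le_cancel_left1)
      ultimately show "3 * p + d * p + (3 * n + 3) \<le> (3 * n + 7) * p"
        by (simp add: algebra_simps)
      show "max 1 (1 / V) \<le> max 1 (1 / V) powr p"
        using powr_mono[of 1 p "max 1 (1 / V)"] p by simp
    qed auto
    finally show "2 powr p * 2 powr (p - 1) * 2 powr (2 * n + 1 + d * p) * (2 powr 2 * 2 powr n) * p * (1 / V)
        \<le> frac_const n powr p"
      by (simp add: frac_const_def powr_mult powr_powr V_def flip: powr_realpow)
  qed (use d r in auto)
  finally show ?thesis .
qed

definition wint :: "('a::euclidean_space \<Rightarrow> real) \<Rightarrow> 'a set \<Rightarrow> ennreal" where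
  "wint w S = (\<integral>\<^sup>+x\<in>S. ennreal (w x) \<partial>lborel)"

lemma wint_mono: "S \<subseteq> T \<Longrightarrow> wint w S \<le> wint w T"
  unfolding wint_def by (intro nn_integral_mono) (auto simp: indicator_def)

text \<open>The pointwise bound is integrated against \<open>w\<close> over the level set
  \<open>E\<close>. After exchanging the integrals, what has to be bounded at scale \<open>k\<close>
  is the mass of \<open>E\<close> near a point \<open>u\<close>, and the \<open>A1\<close> condition
  compares it with \<open>w u\<close>.\<close>

lemma frac_poincare_weak:
  fixes f w :: "'a::euclidean_space \<Rightarrow> real" and p d r :: real
  assumes [measurable]: "f \<in> borel_measurable borel" "w \<in> borel_measurable borel"
    and f: "set_integrable lborel (ball z r) f"
    and n: "2 \<le> DIM('a)" and p: "1 \<le> p" and d: "0 < d" "d < 1" and r: "0 < r"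
    and w: "\<And>x. 0 \<le> w x" and W: "0 \<le> W"
    and A1: "AE y in lborel. \<forall>c \<rho>. 0 < \<rho> \<longrightarrow> y \<in> ball c \<rho> \<longrightarrow>
        wint w (ball c \<rho>) \<le> ennreal (W * w y) * emeasure lborel (ball c \<rho>)"
    and b: "wint w (ball z r) = ennreal b" "0 < b"
    and t: "0 < t" and e: "wint w {x \<in> ball z r. t \<le> \<bar>f x - lavg f (ball z r)\<bar>} = ennreal e" "0 \<le> e"
  defines "a \<equiv> DIM('a) + d * p"
  assumes I: "(\<integral>\<^sup>+x\<in>ball z r. frac_grad a p f (ball z r) x * ennreal (w x) \<partial>lborel) = ennreal I" "0 \<le> I"
  shows "t powr p * e \<le> frac_const DIM('a) powr p * (1 - d) * W * r powr (d * p) / d powr p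
    * (e / b) powr (d / DIM('a)) * I"
proof -
  define B where "B = ball z r"
  define E where "E = {x \<in> B. t \<le> \<bar>f x - lavg f B\<bar>}"
  define n where "n = DIM('a)"
  define V where "V = unit_ball_vol (real n)"
  define G where "G = frac_grad a p f B"
  define \<rho> where "\<rho> k = r / 2 ^ k" for k :: nat
  define C where "C = 2 powr (2 * n + 1 + d * p) / V\<^sup>2 * p * (1 - d)"
  define Y where "Y = 2 / d * r powr d"
  define X where "X x = (\<Sum>k. ennreal (\<rho> k powr (d - n)) * (\<integral>\<^sup>+u\<in>B \<inter> ball x (2 * \<rho> k). G u \<partial>lborel))" for x
  \<comment> \<open>\<open>r * \<tau>\<close> is the scale at which the bounds \<open>l1\<close> and \<open>l2\<close> below balance.\<close>
  define \<tau> where "\<tau> = (e / b) powr (1 / n)"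
  have n2: "2 \<le> n" using n by (simp add: n_def)
  have V: "0 < V" by (simp add: V_def)
  have \<rho>: "0 < \<rho> k" for k using r by (simp add: \<rho>_def)
  have C: "0 < C" using p d V by (simp add: C_def)
  have Y: "0 < Y" using d r by (simp add: Y_def)
  have [measurable]: "B \<in> sets borel" "E \<in> sets borel" by (simp_all add: B_def E_def)
  have [measurable]: "G \<in> borel_measurable borel" unfolding G_def by measurable
  have vol: "emeasure lborel (ball c \<epsilon>) = ennreal (V * \<epsilon> ^ n)" if "0 < \<epsilon>" for c :: 'a and \<epsilon>
    using that by (simp add: emeasure_ball V_def n_def)
  have "AE x in lborel. G x * ennreal (w x) * indicator B x \<noteq> \<infinity>"
  proof (rule nn_integral_PInf_AE)
    show "(\<integral>\<^sup>+x\<in>B. G x * ennreal (w x) \<partial>lborel) \<noteq> \<infinity>"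
      using I by (simp add: B_def G_def)
  qed measurable
  \<comment> \<open>As \<open>w > 0\<close> almost everywhere on \<open>B\<close>, almost every point is a Lebesgue point of \<open>f\<close>.\<close>
  then have fin: "AE x in lborel. x \<in> B \<longrightarrow> G x < \<infinity>"
    using A1
  proof eventually_elim
    case (elim x)
    show ?case
    proof
      assume x: "x \<in> B"
      then have "ennreal b \<le> ennreal (W * w x) * ennreal (V * r ^ n)"
        using elim(2)[rule_format, of r z] x b r vol by (simp add: B_def)
      then have "w x \<noteq> 0" using b by (auto simp: ennreal_eq_0_iff)
      then have "ennreal (w x) \<noteq> 0" using w[of x] by (simp add: ennreal_eq_0_iff)
      then show "G x < \<infinity>" using elim(1) x by (auto simp: less_top ennreal_mult_eq_top_iff)
    qed
  qed
  have pt: "AE x in lborel. x \<in> E \<longrightarrow> ennreal (t powr p) \<le> ennreal (2 powr p * Y powr (p - 1) * C) * X x"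
    using fin
  proof eventually_elim
    case (elim x)
    show ?case
    proof
      assume xE: "x \<in> E"
      \<comment> \<open>With this \<open>s\<close> the first term \<open>s * Y\<close> of the pointwise bound is absorbed by \<open>t\<close>.\<close>
      define s where "s = t / (2 * Y)"
      have s: "0 < s" using t Y by (simp add: s_def)
      have "ennreal t \<le> ennreal \<bar>f x - lavg f B\<bar>" using xE by (auto simp: E_def intro: ennreal_leI)
      also have "\<dots> \<le> ennreal (s * Y) + ennreal (s powr (1 - p) * C) * X x"
        unfolding Y_def C_def X_def B_def G_def \<rho>_def n_def V_def a_def
        using xE elim by (intro abs_diff_lavg_le_riesz assms(1) f p d r s) (auto simp: E_def B_def G_def a_def)
      finally have le: "ennreal t \<le> ennreal (s * Y) + ennreal (s powr (1 - p) * C) * X x" .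
      show "ennreal (t powr p) \<le> ennreal (2 powr p * Y powr (p - 1) * C) * X x"
      proof (cases "X x")
        case (real \<xi>)
        have "t \<le> s * Y + s powr (1 - p) * C * \<xi>"
          using le real s Y C by (simp flip: ennreal_mult ennreal_plus)
        then have "t / 2 \<le> s powr (1 - p) * C * \<xi>" using Y by (simp add: s_def)
        then have "2 * t powr (p - 1) * (t / 2) \<le> 2 * t powr (p - 1) * (s powr (1 - p) * C * \<xi>)"
          by (intro mult_left_mono) auto
        also have "s powr (1 - p) = 2 powr (p - 1) * Y powr (p - 1) / t powr (p - 1)"
          using t Y by (simp add: s_def powr_divide powr_mult powr_diff)
        also have "2 * t powr (p - 1) * (2 powr (p - 1) * Y powr (p - 1) / t powr (p - 1) * C * \<xi>)
            = 2 powr p * Y powr (p - 1) * C * \<xi>"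
          using t by (simp add: powr_diff)
        also have "2 * t powr (p - 1) * (t / 2) = t powr p"
          using t by (simp add: powr_diff)
        finally show ?thesis using real C by (simp flip: ennreal_mult add: ennreal_leI)
      next
        case top
        then show ?thesis using C Y by (simp add: ennreal_mult_top)
      qed
    qed
  qed
  have e_le: "e \<le> b"
  proof -
    have "ennreal e \<le> ennreal b"
      unfolding b(1)[symmetric] e(1)[symmetric] by (intro wint_mono) auto
    then show ?thesis using b by simp
  qed
  have \<tau>: "0 \<le> \<tau>" "\<tau> ^ n = e / b"
    using e b n2 by (cases "e = 0"; auto simp: \<tau>_def powr_powr simp flip: powr_realpow)+
  have wE: "wint w E = ennreal e" using e by (simp add: E_def B_def)
  let ?m = "\<lambda>k. 2 powr (- (real k * d)) * min 1 ((2 ^ k * \<tau>) ^ n)"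
  \<comment> \<open>Two bounds compete: \<open>A1\<close> on the ball around \<open>u\<close> gives
    \<open>l1\<close>, which is good for small radii; the total mass \<open>e\<close> of
    \<open>E\<close> and \<open>A1\<close> on \<open>B\<close> give \<open>l2\<close>, which is good
    for large ones. Their minimum makes the sum over \<open>k\<close> of order
    \<open>\<tau> powr d\<close>.\<close>
  have loc: "AE u in lborel. \<forall>k. u \<in> B \<longrightarrow> ennreal (\<rho> k powr (d - n)) * wint w (E \<inter> ball u (2 * \<rho> k))
      \<le> ennreal (2 ^ n * V * r powr d * W * ?m k) * ennreal (w u)"
    using A1
  proof eventually_elim
    case (elim u)
    show ?case
    proof (intro allI impI)
      fix k assume u: "u \<in> B"
      have "wint w (E \<inter> ball u (2 * \<rho> k)) \<le> wint w (ball u (2 * \<rho> k))"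
        by (intro wint_mono) auto
      also have "\<dots> \<le> ennreal (W * w u) * ennreal (V * (2 * \<rho> k) ^ n)"
        using elim \<rho>[of k] vol by (metis centre_in_ball mult_pos_pos zero_less_numeral)
      also have "\<dots> = ennreal (W * w u * (V * (2 * \<rho> k) ^ n))"
        using W w[of u] V \<rho>[of k] by (simp add: ennreal_mult)
      finally have l1: "wint w (E \<inter> ball u (2 * \<rho> k)) \<le> ennreal (W * w u * (V * (2 * \<rho> k) ^ n))" .
      have "ennreal b \<le> ennreal (W * w u) * ennreal (V * r ^ n)"
        using elim[rule_format, of r z] b r vol u by (simp add: B_def)
      also have "\<dots> = ennreal (W * w u * (V * r ^ n))"
        using W w[of u] V r by (simp add: ennreal_mult)
      finally have "b \<le> W * w u * (V * r ^ n)"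
        using W w[of u] V r by simp
      then have "\<tau> ^ n * b \<le> \<tau> ^ n * (W * w u * (V * r ^ n))"
        by (rule mult_left_mono[OF _ zero_le_power[OF \<tau>(1)]])
      moreover have "\<tau> ^ n * b = e" using \<tau> b by simp
      ultimately have "e \<le> W * w u * (V * (\<tau> * r) ^ n)" by (simp add: power_mult_distrib mult_ac)
      \<comment> \<open>A factor \<open>2 ^ n\<close> is given away so that \<open>l2\<close> has
        the same shape as \<open>l1\<close> and the minimum can be factored out.\<close>
      also have "\<dots> \<le> W * w u * (V * (2 * \<tau> * r) ^ n)"
        using W w[of u] V r \<tau> by (intro mult_left_mono power_mono mult_right_mono) auto
      finally have "ennreal e \<le> ennreal (W * w u * (V * (2 * \<tau> * r) ^ n))" by (rule ennreal_leI)
      moreover have "wint w (E \<inter> ball u (2 * \<rho> k)) \<le> ennreal e"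
        unfolding wE[symmetric] by (intro wint_mono) auto
      ultimately have l2: "wint w (E \<inter> ball u (2 * \<rho> k)) \<le> ennreal (W * w u * (V * (2 * \<tau> * r) ^ n))"
        by (rule order_trans[rotated])
      have "(2 * \<rho> k) ^ n = (2 * r) ^ n / (2 ^ k) ^ n"
        by (simp add: \<rho>_def power_divide)
      moreover have "(2 * \<tau> * r) ^ n = (2 * r) ^ n / (2 ^ k) ^ n * (2 ^ k * \<tau>) ^ n"
        by (simp add: power_mult_distrib)
      ultimately have l3: "wint w (E \<inter> ball u (2 * \<rho> k))
          \<le> ennreal (W * w u * (V * ((2 * r) ^ n / (2 ^ k) ^ n * min 1 ((2 ^ k * \<tau>) ^ n))))"
        using l1 l2 by (cases "1 \<le> (2 ^ k * \<tau>) ^ n") (simp_all add: min_def)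
      have "ennreal (\<rho> k powr (d - n)) * wint w (E \<inter> ball u (2 * \<rho> k))
          \<le> ennreal (\<rho> k powr (d - n)) * ennreal (W * w u * (V * ((2 * r) ^ n / (2 ^ k) ^ n * min 1 ((2 ^ k * \<tau>) ^ n))))"
        by (intro mult_left_mono l3) simp
      also have "\<dots> = ennreal (\<rho> k powr (d - n) * (W * w u * (V * ((2 * r) ^ n / (2 ^ k) ^ n * min 1 ((2 ^ k * \<tau>) ^ n)))))"
        using W w[of u] V r \<tau> by (intro ennreal_mult[symmetric]) auto
      also have "\<rho> k powr (d - n) * (W * w u * (V * ((2 * r) ^ n / (2 ^ k) ^ n * min 1 ((2 ^ k * \<tau>) ^ n))))
          = 2 ^ n * V * r powr d * W * ?m k * w u"
      proof -
        have key: "\<rho> k powr (d - n) * ((2 * r) ^ n / (2 ^ k) ^ n) = 2 ^ n * r powr d * 2 powr (- (real k * d))"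
        proof -
          have "\<rho> k powr (d - n) = \<rho> k powr d / \<rho> k ^ n"
            using \<rho>[of k] by (simp add: powr_diff powr_realpow)
          moreover have "(2 * r) ^ n / (2 ^ k) ^ n = 2 ^ n * \<rho> k ^ n"
            by (simp add: \<rho>_def power_divide power_mult_distrib)
          moreover have "\<rho> k powr d = r powr d * 2 powr (- (real k * d))"
            using r by (simp add: \<rho>_def powr_divide powr_minus_divide powr_powr flip: powr_realpow)
          ultimately show ?thesis using \<rho>[of k] by simp
        qed
        have "\<rho> k powr (d - n) * (W * w u * (V * ((2 * r) ^ n / (2 ^ k) ^ n * min 1 ((2 ^ k * \<tau>) ^ n))))
            = \<rho> k powr (d - n) * ((2 * r) ^ n / (2 ^ k) ^ n) * (W * w u * V * min 1 ((2 ^ k * \<tau>) ^ n))"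
          by (simp only: mult_ac)
        also have "\<dots> = 2 ^ n * V * r powr d * W * ?m k * w u"
          unfolding key by (simp only: mult_ac)
        finally show ?thesis .
      qed
      also have "ennreal (2 ^ n * V * r powr d * W * ?m k * w u) = ennreal (2 ^ n * V * r powr d * W * ?m k) * ennreal (w u)"
        using w by (simp add: ennreal_mult'')
      finally show "ennreal (\<rho> k powr (d - n)) * wint w (E \<inter> ball u (2 * \<rho> k))
          \<le> ennreal (2 ^ n * V * r powr d * W * ?m k) * ennreal (w u)" .
    qed
  qed
  let ?I = "\<integral>\<^sup>+u\<in>B. G u * ennreal (w u) \<partial>lborel"
  have each: "(\<integral>\<^sup>+x\<in>E. (ennreal (\<rho> k powr (d - n)) * (\<integral>\<^sup>+u\<in>B \<inter> ball x (2 * \<rho> k). G u \<partial>lborel)) * ennreal (w x) \<partial>lborel)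
      \<le> ennreal (2 ^ n * V * r powr d * W * ?m k) * ?I" for k
  proof -
    \<comment> \<open>Written through \<open>dist\<close>, the indicator is jointly measurable in
      \<open>x\<close> and \<open>u\<close>, and its symmetry turns the ball around \<open>x\<close>
      into one around \<open>u\<close> after Fubini.\<close>
    have ib: "indicator (ball x R) u = indicator {..<R} (dist x u)" for x u :: 'a and R :: real
      by (simp add: indicator_def)
    have "(\<integral>\<^sup>+x\<in>E. (ennreal (\<rho> k powr (d - n)) * (\<integral>\<^sup>+u\<in>B \<inter> ball x (2 * \<rho> k). G u \<partial>lborel)) * ennreal (w x) \<partial>lborel)
       = (\<integral>\<^sup>+x. (\<integral>\<^sup>+u. ennreal (\<rho> k powr (d - n)) * (G u * indicator B u) *
            (ennreal (w x) * indicator E x * indicator {..<2 * \<rho> k} (dist x u)) \<partial>lborel) \<partial>lborel)"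
      unfolding indicator_inter_arith ib
      by (simp add: nn_integral_cmult[symmetric] nn_integral_multc[symmetric] mult_ac)
    also have "\<dots> = (\<integral>\<^sup>+u. (\<integral>\<^sup>+x. ennreal (\<rho> k powr (d - n)) * (G u * indicator B u) *
            (ennreal (w x) * indicator E x * indicator {..<2 * \<rho> k} (dist x u)) \<partial>lborel) \<partial>lborel)"
      by (rule lborel_pair.Fubini') (simp add: split_beta')
    also have "\<dots> = (\<integral>\<^sup>+u. (G u * indicator B u) * (ennreal (\<rho> k powr (d - n)) * wint w (E \<inter> ball u (2 * \<rho> k))) \<partial>lborel)"
    proof (intro nn_integral_cong)
      fix u
      have "(\<integral>\<^sup>+x. ennreal (\<rho> k powr (d - n)) * (G u * indicator B u) *
            (ennreal (w x) * indicator E x * indicator {..<2 * \<rho> k} (dist x u)) \<partial>lborel)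
          = ennreal (\<rho> k powr (d - n)) * (G u * indicator B u) *
            (\<integral>\<^sup>+x. ennreal (w x) * indicator E x * indicator {..<2 * \<rho> k} (dist x u) \<partial>lborel)"
        by (rule nn_integral_cmult) measurable
      then show "(\<integral>\<^sup>+x. ennreal (\<rho> k powr (d - n)) * (G u * indicator B u) *
            (ennreal (w x) * indicator E x * indicator {..<2 * \<rho> k} (dist x u)) \<partial>lborel)
          = (G u * indicator B u) * (ennreal (\<rho> k powr (d - n)) * wint w (E \<inter> ball u (2 * \<rho> k)))"
        unfolding wint_def indicator_inter_arith ib by (simp add: dist_commute mult_ac)
    qed
    also have "\<dots> \<le> (\<integral>\<^sup>+u. ennreal (2 ^ n * V * r powr d * W * ?m k) * (G u * ennreal (w u) * indicator B u) \<partial>lborel)"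
    proof (rule nn_integral_mono_AE)
      show "AE u in lborel. (G u * indicator B u) * (ennreal (\<rho> k powr (d - n)) * wint w (E \<inter> ball u (2 * \<rho> k)))
          \<le> ennreal (2 ^ n * V * r powr d * W * ?m k) * (G u * ennreal (w u) * indicator B u)"
        using loc
      proof eventually_elim
        case (elim u)
        show ?case
        proof (cases "u \<in> B")
          case True
          then show ?thesis using mult_left_mono[OF elim[rule_format, of k], of "G u"] by (simp add: mult_ac)
        qed simp
      qed
    qed
    also have "\<dots> = ennreal (2 ^ n * V * r powr d * W * ?m k) * ?I"
      by (simp add: nn_integral_cmult)
    finally show ?thesis .
  qed
  have Xm [measurable]: "(\<lambda>x. \<integral>\<^sup>+u\<in>B \<inter> ball x (2 * \<rho> k). G u \<partial>lborel) \<in> borel_measurable borel" for k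
  proof -
    have ib: "indicator (ball x R) u = indicator {..<R} (dist x u)" for x u :: 'a and R :: real
      by (simp add: indicator_def)
    show ?thesis unfolding indicator_inter_arith ib by measurable
  qed
  have [measurable]: "X \<in> borel_measurable borel" unfolding X_def by measurable
  have "ennreal (t powr p * e) = ennreal (t powr p) * wint w E"
    using e wE by (simp add: ennreal_mult)
  also have "\<dots> = (\<integral>\<^sup>+x\<in>E. ennreal (t powr p) * ennreal (w x) \<partial>lborel)"
    unfolding wint_def by (subst nn_integral_cmult[symmetric]) (auto simp: mult_ac)
  also have "\<dots> \<le> (\<integral>\<^sup>+x\<in>E. (ennreal (2 powr p * Y powr (p - 1) * C) * X x) * ennreal (w x) \<partial>lborel)"
  proof (rule nn_integral_mono_AE)
    show "AE x in lborel. ennreal (t powr p) * ennreal (w x) * indicator E x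
        \<le> (ennreal (2 powr p * Y powr (p - 1) * C) * X x) * ennreal (w x) * indicator E x"
      using pt by eventually_elim (auto simp: indicator_def intro!: mult_right_mono)
  qed
  also have "\<dots> = ennreal (2 powr p * Y powr (p - 1) * C) * (\<integral>\<^sup>+x\<in>E. X x * ennreal (w x) \<partial>lborel)"
    by (subst nn_integral_cmult[symmetric]) (measurable, simp only: mult.assoc)
  also have "(\<integral>\<^sup>+x\<in>E. X x * ennreal (w x) \<partial>lborel)
      = (\<Sum>k. \<integral>\<^sup>+x\<in>E. (ennreal (\<rho> k powr (d - n)) * (\<integral>\<^sup>+u\<in>B \<inter> ball x (2 * \<rho> k). G u \<partial>lborel)) * ennreal (w x) \<partial>lborel)"
    unfolding X_def ennreal_suminf_multc[symmetric] by (rule nn_integral_suminf) measurable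
  also have "\<dots> \<le> (\<Sum>k. ennreal (2 ^ n * V * r powr d * W * ?m k) * ?I)"
    by (intro suminf_le each) auto
  also have "\<dots> = (\<Sum>k. ennreal (2 ^ n * V * r powr d * W * ?m k)) * ?I"
    by simp
  also have "(\<Sum>k. ennreal (2 ^ n * V * r powr d * W * ?m k)) \<le> ennreal (2 ^ n * V * r powr d * W * (4 / d * \<tau> powr d))"
  proof (rule suminf_le_const)
    show "(\<Sum>k<K. ennreal (2 ^ n * V * r powr d * W * ?m k)) \<le> ennreal (2 ^ n * V * r powr d * W * (4 / d * \<tau> powr d))" for K
    proof -
      have "(\<Sum>k<K. ennreal (2 ^ n * V * r powr d * W * ?m k)) = ennreal (2 ^ n * V * r powr d * W * (\<Sum>k<K. ?m k))"
        unfolding sum_distrib_left using V W \<tau> by (intro sum_ennreal) auto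
      also have "\<dots> \<le> ennreal (2 ^ n * V * r powr d * W * (4 / d * \<tau> powr d))"
        using V W \<tau> d n2 by (intro ennreal_leI mult_left_mono sum_two_powr_min_le) auto
      finally show ?thesis .
    qed
  qed auto
  also have "?I = ennreal I" using I by (simp add: B_def G_def)
  also have "ennreal (2 powr p * Y powr (p - 1) * C) * (ennreal (2 ^ n * V * r powr d * W * (4 / d * \<tau> powr d)) * ennreal I)
      = ennreal (2 powr p * Y powr (p - 1) * C * (2 ^ n * V * r powr d * W * (4 / d * \<tau> powr d) * I))"
    using I C V W d by (simp flip: ennreal_mult)
  finally have "ennreal (t powr p * e) \<le> ennreal (2 powr p * Y powr (p - 1) * C * (2 ^ n * V * r powr d * W * (4 / d * \<tau> powr d) * I))"
    by (simp add: mult_left_mono mult_right_mono)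
  then have "t powr p * e \<le> 2 powr p * Y powr (p - 1) * C * (2 ^ n * V * r powr d * W * (4 / d * \<tau> powr d) * I)"
    using I C V W d by (simp add: ennreal_le_iff)
  also have "\<dots> = (2 powr p * Y powr (p - 1) * (2 powr (2 * n + 1 + d * p) / V\<^sup>2 * p) * (4 / d * (2 ^ n * V * r powr d)))
      * ((1 - d) * W * \<tau> powr d * I)"
    by (simp add: C_def mult_ac)
  also have "\<dots> \<le> (frac_const n powr p * r powr (d * p) / d powr p) * ((1 - d) * W * \<tau> powr d * I)"
    unfolding Y_def V_def using d W I by (intro mult_right_mono weak_const_le_frac_const p r) auto
  also have "\<tau> powr d = (e / b) powr (d / n)"
    by (simp add: \<tau>_def powr_powr)
  finally show ?thesis by (simp add: n_def mult_ac)
qed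

section \<open>Truncation\<close>

text \<open>Each \<open>a i powr p\<close> is at most \<open>a i\<close> times the total to the
  power \<open>p - 1\<close>.\<close>

lemma sum_powr_le_powr_sum:
  fixes a :: "'b \<Rightarrow> real"
  assumes "finite A" "\<And>i. i \<in> A \<Longrightarrow> 0 \<le> a i" "1 \<le> p"
  shows "(\<Sum>i\<in>A. a i powr p) \<le> (\<Sum>i\<in>A. a i) powr p"
proof -
  have split: "x powr p = x * x powr (p - 1)" if "0 \<le> x" for x :: real
    using that powr_add[of x 1 "p - 1"] by (cases "x = 0") auto
  have "(\<Sum>i\<in>A. a i powr p) \<le> (\<Sum>i\<in>A. a i * (\<Sum>i\<in>A. a i) powr (p - 1))"
    using assms by (intro sum_mono) (auto simp: split intro!: mult_left_mono powr_mono2 member_le_sum)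
  also have "\<dots> = (\<Sum>i\<in>A. a i) powr p"
    using assms by (simp add: split sum_nonneg flip: sum_distrib_right)
  finally show ?thesis .
qed

text \<open>The part of \<open>s\<close> between the heights \<open>2 ^ k * T\<close> and
  \<open>2 ^ (k + 1) * T\<close>.\<close>

definition layer :: "real \<Rightarrow> nat \<Rightarrow> real \<Rightarrow> real" where
  "layer T k s = min (max (s - 2 ^ k * T) 0) (2 ^ k * T)"

lemma layer_mono: "s \<le> s' \<Longrightarrow> layer T k s \<le> layer T k s'"
  by (auto simp: layer_def)

lemma sum_layer:
  assumes "0 < T"
  shows "(\<Sum>k<N. layer T k s) = min (max (s - T) 0) ((2 ^ N - 1) * T)"
proof (induction N)
  case (Suc N)
  define A where "A = 2 ^ N * T"
  have "T \<le> A" using assms by (simp add: A_def)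
  then have "min (max (s - T) 0) (A - T) + min (max (s - A) 0) A = min (max (s - T) 0) (2 * A - T)"
    using assms by (auto simp: min_def max_def)
  then show ?case unfolding sum.lessThan_Suc Suc by (simp add: layer_def A_def algebra_simps)
qed (use assms in \<open>simp add: layer_def\<close>)

text \<open>All layers are monotone in \<open>s\<close>, so the absolute values have one common sign
  and can be summed first; by \<open>sum_layer\<close> the sum of the layers is a truncation, hence
  1-Lipschitz.\<close>

lemma sum_abs_diff_layer_le:
  assumes "0 < T"
  shows "(\<Sum>k<N. \<bar>layer T k s - layer T k s'\<bar>) \<le> \<bar>s - s'\<bar>"
proof -
  have *: "(\<Sum>k<N. \<bar>layer T k s - layer T k s'\<bar>) \<le> s - s'" if "s' \<le> s" for s s'
  proof -
    have "(\<Sum>k<N. \<bar>layer T k s - layer T k s'\<bar>) = (\<Sum>k<N. layer T k s) - (\<Sum>k<N. layer T k s')"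
      unfolding sum_subtractf[symmetric] using layer_mono[OF that] by (intro sum.cong) auto
    also have "\<dots> \<le> s - s'"
      unfolding sum_layer[OF assms] using that by (simp add: min_def max_def)
    finally show ?thesis .
  qed
  show ?thesis using *[of s' s] *[of s s'] by (cases "s' \<le> s") (auto simp: abs_minus_commute)
qed

text \<open>A value \<open>u \<ge> 2 * T\<close> lies in some
  \<open>[2 ^ (k + 1) * T, 2 ^ (k + 2) * T)\<close>, and the \<open>k\<close>-th term alone bounds
  it; smaller values are covered by the first term.\<close>

lemma powr_le_sum_layers:
  fixes u T q :: real
  assumes "0 < T" "0 \<le> u" "0 < q"
  shows "ennreal (u powr q) \<le> ennreal ((2 * T) powr q) + (\<Sum>k. ennreal ((2 ^ (k + 2) * T) powr q) * indicator {2 ^ (k + 1) * T..} u)"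
proof (cases "u < 2 * T")
  case True
  then have "ennreal (u powr q) \<le> ennreal ((2 * T) powr q)"
    using assms by (intro ennreal_leI powr_mono2) auto
  then show ?thesis by (rule order_trans) simp
next
  case False
  obtain m :: nat where m: "u / T < 2 ^ m" using real_arch_pow[of 2 "u / T"] by auto
  then have m': "u < 2 ^ (m + 1) * T"
    using assms by (simp add: field_simps)
  define P where "P j \<longleftrightarrow> u < 2 ^ (j + 1) * T" for j :: nat
  define l where "l = (LEAST j. P j)"
  have "P m" using m' by (simp add: P_def)
  then have l: "P l" unfolding l_def by (rule LeastI)
  have "l \<noteq> 0" using l False by (intro notI) (simp add: P_def)
  then obtain k where k: "l = Suc k" by (cases l) auto
  have nk: "\<not> P k" using not_less_Least[of k P] k by (simp add: l_def)
  define h where "h k = ennreal ((2 ^ (k + 2) * T) powr q) * indicator {2 ^ (k + 1) * T..} u" for k :: nat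
  have "ennreal (u powr q) \<le> ennreal ((2 ^ (k + 2) * T) powr q)"
    using l k assms by (intro ennreal_leI powr_mono2) (auto simp: P_def)
  also have "\<dots> = h k" using nk by (simp add: P_def h_def)
  also have "\<dots> \<le> (\<Sum>k. h k)" using sum_le_suminf[of h "{k}"] by simp
  finally show ?thesis unfolding h_def by (rule order_trans) simp
qed

text \<open>The weak estimate is assumed for every \<open>v\<close> because it is applied to
  \<open>f\<close> and to each layer \<open>v k\<close> of \<open>u\<close>. The layers share the
  energy \<open>I\<close> of \<open>f\<close>, and as \<open>\<kappa> \<ge> 1\<close> their weak
  bounds can be summed. The condition on \<open>T\<close> makes the set where \<open>u < T\<close>
  carry at least half of the mass.\<close>

lemma truncation_strong_of_weak:
  fixes f w :: "'a::euclidean_space \<Rightarrow> real" and p \<kappa> K b a I T :: real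
  assumes [measurable]: "f \<in> borel_measurable borel" "w \<in> borel_measurable borel" "B \<in> sets borel"
    and f: "set_integrable lborel B f" and B: "emeasure lborel B < \<infinity>"
    and p: "1 \<le> p" and \<kappa>: "1 \<le> \<kappa>" and K: "0 \<le> K"
    and b: "wint w B = ennreal b" "0 < b"
    and weak: "\<And>v t e I. v \<in> borel_measurable borel \<Longrightarrow> set_integrable lborel B v \<Longrightarrow> 0 < t \<Longrightarrow>
        wint w {x \<in> B. t \<le> \<bar>v x - lavg v B\<bar>} = ennreal e \<Longrightarrow> 0 \<le> e \<Longrightarrow>
        (\<integral>\<^sup>+x\<in>B. frac_grad a p v B x * ennreal (w x) \<partial>lborel) = ennreal I \<Longrightarrow> 0 \<le> I \<Longrightarrow>
        t powr (p * \<kappa>) * (e / b) \<le> (K * I / b) powr \<kappa>"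
    and I: "(\<integral>\<^sup>+x\<in>B. frac_grad a p f B x * ennreal (w x) \<partial>lborel) = ennreal I" "0 \<le> I"
    and T: "0 < T" "2 * (K * I / b) powr \<kappa> \<le> T powr (p * \<kappa>)"
  shows "(\<integral>\<^sup>+x\<in>B. ennreal (\<bar>f x - lavg f B\<bar> powr (p * \<kappa>)) * ennreal (w x) \<partial>lborel)
    \<le> ennreal ((10 * T) powr (p * \<kappa>) * b)"
proof -
  define q where "q = p * \<kappa>"
  have q: "1 \<le> q" using mult_mono[of 1 p 1 \<kappa>] p \<kappa> by (simp add: q_def)
  define u where "u x = \<bar>f x - lavg f B\<bar>" for x
  define v where "v k x = layer T k (u x)" for k x
  define E where "E k = {x \<in> B. 2 ^ (k + 1) * T \<le> u x}" for k :: nat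
  define e where "e k = enn2real (wint w (E k))" for k
  have [measurable]: "u \<in> borel_measurable borel" unfolding u_def by measurable
  have [measurable]: "v k \<in> borel_measurable borel" for k unfolding v_def layer_def by measurable
  have [measurable]: "E k \<in> sets borel" for k unfolding E_def by measurable
  have fin: "\<exists>e. wint w S = ennreal e \<and> 0 \<le> e \<and> e \<le> b" if "S \<subseteq> B" for S
  proof -
    have "wint w S \<le> ennreal b" using wint_mono[OF that, of w] b by simp
    then show ?thesis using b by (cases "wint w S") (auto simp: top_unique)
  qed
  have e: "wint w (E k) = ennreal (e k)" "0 \<le> e k" "e k \<le> b" for k
    using fin[of "E k"] by (auto simp: e_def E_def)
  have vint: "set_integrable lborel B (v k)" for k
  proof (rule set_integrable_bound)
    show "set_integrable lborel B (\<lambda>_. 2 ^ k * T)" using B by (simp add: set_integrable_def)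
    show "AE x in lborel. x \<in> B \<longrightarrow> norm (v k x) \<le> norm (2 ^ k * T)"
      using T by (auto simp: v_def layer_def)
  qed (simp add: set_borel_measurable_def)
  define J where "J k = (\<integral>\<^sup>+x\<in>B. frac_grad a p (v k) B x * ennreal (w x) \<partial>lborel)" for k
  have pt: "(\<Sum>k<N. \<bar>v k x - v k y\<bar> powr p) \<le> \<bar>f x - f y\<bar> powr p" for N x y
  proof -
    have "(\<Sum>k<N. \<bar>v k x - v k y\<bar> powr p) \<le> (\<Sum>k<N. \<bar>v k x - v k y\<bar>) powr p"
      by (intro sum_powr_le_powr_sum) (auto simp: p)
    also have "\<dots> \<le> \<bar>f x - f y\<bar> powr p"
    proof (rule powr_mono2)
      have "(\<Sum>k<N. \<bar>v k x - v k y\<bar>) \<le> \<bar>u x - u y\<bar>"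
        unfolding v_def by (rule sum_abs_diff_layer_le[OF T(1)])
      also have "\<dots> \<le> \<bar>f x - f y\<bar>" by (simp add: u_def)
      finally show "(\<Sum>k<N. \<bar>v k x - v k y\<bar>) \<le> \<bar>f x - f y\<bar>" .
    qed (use p in \<open>auto intro: sum_nonneg\<close>)
    finally show ?thesis .
  qed
  \<comment> \<open>The energies of the layers add up to at most that of \<open>f\<close>, by
    integrating \<open>pt\<close>.\<close>
  have Jsum: "(\<Sum>k<N. J k) \<le> ennreal I" for N
  proof -
    have g: "(\<Sum>k<N. frac_grad a p (v k) B x) \<le> frac_grad a p f B x" for x
    proof -
      have "(\<Sum>k<N. frac_grad a p (v k) B x)
          = (\<integral>\<^sup>+y. (\<Sum>k<N. ennreal (\<bar>v k x - v k y\<bar> powr p / norm (x - y) powr a) * indicator B y) \<partial>lborel)"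
        unfolding frac_grad_def by (rule nn_integral_sum[symmetric]) measurable
      also have "\<dots> \<le> frac_grad a p f B x"
        unfolding frac_grad_def sum_distrib_right[symmetric]
        by (intro nn_integral_mono mult_right_mono)
          (auto simp: sum_divide_distrib[symmetric] intro!: ennreal_leI divide_right_mono pt)
      finally show ?thesis .
    qed
    have "(\<Sum>k<N. J k) = (\<integral>\<^sup>+x. (\<Sum>k<N. frac_grad a p (v k) B x * ennreal (w x) * indicator B x) \<partial>lborel)"
      unfolding J_def by (rule nn_integral_sum[symmetric]) measurable
    also have "\<dots> \<le> ennreal I"
      unfolding I(1)[symmetric] sum_distrib_right[symmetric] by (intro nn_integral_mono mult_right_mono g) auto
    finally show ?thesis .
  qed
  define j where "j k = enn2real (J k)" for k
  have J: "J k = ennreal (j k)" "0 \<le> j k" for k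
  proof -
    have "J k \<le> (\<Sum>k<Suc k. J k)" by (simp add: add_increasing)
    also have "\<dots> \<le> ennreal I" by (rule Jsum)
    finally show "J k = ennreal (j k)" by (cases "J k") (auto simp: j_def top_unique)
  qed (simp add: j_def)
  have jsum: "(\<Sum>k<N. j k) \<le> I" for N
    using Jsum[of N] J I by (simp add: sum_ennreal)
  have jnonneg: "0 \<le> (\<Sum>k<N. j k)" for N
    using J by (intro sum_nonneg) auto
  obtain l where l: "wint w {x \<in> B. T \<le> u x} = ennreal l" "0 \<le> l" "l \<le> b"
    using fin[of "{x \<in> B. T \<le> u x}"] by auto
  have "T powr q * (l / b) \<le> (K * I / b) powr \<kappa>"
    unfolding q_def by (rule weak[OF assms(1) f T(1) l(1)[unfolded u_def] l(2) I])
  then have "T powr q * (l / b) \<le> T powr q * (1 / 2)" using T(2) unfolding q_def by linarith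
  then have "l / b \<le> 1 / 2" using T by (subst (asm) mult_le_cancel_left_pos) auto
  then have l2: "2 * l \<le> b" using b by (simp add: field_simps)
  have low: "ennreal (b / 2) \<le> wint w {x \<in> B. u x < T}"
  proof -
    have "wint w B = (\<integral>\<^sup>+x. ennreal (w x) * indicator {x \<in> B. T \<le> u x} x + ennreal (w x) * indicator {x \<in> B. u x < T} x \<partial>lborel)"
      unfolding wint_def by (intro nn_integral_cong) (auto simp: indicator_def)
    also have "\<dots> = wint w {x \<in> B. T \<le> u x} + wint w {x \<in> B. u x < T}"
      unfolding wint_def by (intro nn_integral_add) measurable
    finally have sum: "ennreal b = ennreal l + wint w {x \<in> B. u x < T}" using b l by simp
    obtain m where m: "wint w {x \<in> B. u x < T} = ennreal m" "0 \<le> m"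
      using fin[of "{x \<in> B. u x < T}"] by auto
    then have "b = l + m" using sum l b by (simp flip: ennreal_plus)
    then show ?thesis using l2 m by (simp add: ennreal_leI)
  qed
  have weak_layer: "(2 ^ k * T / 2) powr q * (e k / 2 / b) \<le> (K * j k / b) powr \<kappa>" for k
  proof -
    \<comment> \<open>Half the height of the layer: the values 0 and \<open>2 ^ k * T\<close> cannot
      both be closer than this to the average.\<close>
    let ?t = "2 ^ k * T / 2"
    let ?F = "{x \<in> B. ?t \<le> \<bar>v k x - lavg (v k) B\<bar>}"
    obtain e' where e': "wint w ?F = ennreal e'" "0 \<le> e'"
      using fin[of ?F] by auto
    \<comment> \<open>\<open>v k\<close> is far from its average on \<open>E k\<close> or on \<open>{u < T}\<close>, which carries half of the mass.\<close>
    have "ennreal (e k / 2) \<le> wint w ?F"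
    proof (cases "lavg (v k) B \<le> ?t")
      case True
      have vE: "v k x = 2 ^ k * T" if "x \<in> E k" for x
        using that T by (auto simp: v_def layer_def E_def)
      have "?t \<le> \<bar>2 ^ k * T - lavg (v k) B\<bar>" using True by linarith
      then have "E k \<subseteq> ?F" by (auto simp: vE) (simp add: E_def)
      then have "wint w (E k) \<le> wint w ?F" by (rule wint_mono)
      then show ?thesis using e[of k] by (auto intro: order_trans[rotated] ennreal_leI)
    next
      case False
      have v0: "v k x = 0" if "u x < T" for x
      proof -
        have "T \<le> 2 ^ k * T" using T by simp
        then have "u x - 2 ^ k * T \<le> 0" using that by linarith
        then show ?thesis using T by (simp add: v_def layer_def)
      qed
      have "wint w {x \<in> B. u x < T} \<le> wint w ?F"
        using False by (intro wint_mono) (auto simp: v0)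
      then have "ennreal (b / 2) \<le> wint w ?F" using low by (rule order_trans[rotated])
      then show ?thesis using e[of k] by (auto intro: order_trans[rotated] ennreal_leI)
    qed
    then have "e k / 2 \<le> e'" using e' by simp
    then have "?t powr q * (e k / 2 / b) \<le> ?t powr q * (e' / b)"
      using b by (intro mult_left_mono divide_right_mono) auto
    also have "\<dots> \<le> (K * j k / b) powr \<kappa>"
      unfolding q_def using T by (intro weak[OF _ vint _ e']) (auto simp: J J_def[symmetric])
    finally show ?thesis .
  qed
  have term_le: "(2 ^ (k + 2) * T) powr q * e k \<le> 8 powr q * 2 * b * (K * j k / b) powr \<kappa>" for k
  proof -
    \<comment> \<open>The ratio between the upper end of the values counted by the
      \<open>k\<close>-th term and the threshold of \<open>weak_layer\<close>.\<close>
    have "2 ^ (k + 2) * T = 8 * (2 ^ k * T / 2)" by simp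
    then have "(2 ^ (k + 2) * T) powr q = 8 powr q * (2 ^ k * T / 2) powr q"
      by (simp only: powr_mult)
    then have "(2 ^ (k + 2) * T) powr q * e k = 8 powr q * 2 * b * ((2 ^ k * T / 2) powr q * (e k / 2 / b))"
      using b by simp
    also have "\<dots> \<le> 8 powr q * 2 * b * (K * j k / b) powr \<kappa>"
      using b by (intro mult_left_mono weak_layer) auto
    finally show ?thesis .
  qed
  have sum_le: "(\<Sum>k<N. (2 ^ (k + 2) * T) powr q * e k) \<le> 8 powr q * b * T powr q" for N
  proof -
    have "(\<Sum>k<N. (2 ^ (k + 2) * T) powr q * e k) \<le> (\<Sum>k<N. 8 powr q * 2 * b * (K * j k / b) powr \<kappa>)"
      by (intro sum_mono term_le)
    also have "\<dots> = 8 powr q * 2 * b * (\<Sum>k<N. (K * j k / b) powr \<kappa>)"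
      by (simp add: sum_distrib_left)
    also have "\<dots> \<le> 8 powr q * 2 * b * (\<Sum>k<N. K * j k / b) powr \<kappa>"
      using b K J by (intro mult_left_mono sum_powr_le_powr_sum) (auto simp: \<kappa>)
    also have "(\<Sum>k<N. K * j k / b) = K * (\<Sum>k<N. j k) / b"
      by (simp add: sum_distrib_left sum_divide_distrib)
    also have "8 powr q * 2 * b * (K * (\<Sum>k<N. j k) / b) powr \<kappa> \<le> 8 powr q * 2 * b * (K * I / b) powr \<kappa>"
      using b K jsum jnonneg \<kappa> by (intro mult_left_mono powr_mono2 divide_right_mono) auto
    also have "\<dots> = 8 powr q * b * (2 * (K * I / b) powr \<kappa>)" by simp
    also have "\<dots> \<le> 8 powr q * b * T powr q"
      unfolding q_def using b T by (intro mult_left_mono) auto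
    finally show ?thesis .
  qed
  have "(\<integral>\<^sup>+x\<in>B. ennreal (u x powr q) * ennreal (w x) \<partial>lborel)
      \<le> (\<integral>\<^sup>+x. ennreal ((2 * T) powr q) * (ennreal (w x) * indicator B x) +
          (\<Sum>k. ennreal ((2 ^ (k + 2) * T) powr q) * (ennreal (w x) * indicator (E k) x)) \<partial>lborel)"
  proof (rule nn_integral_mono)
    fix x
    show "ennreal (u x powr q) * ennreal (w x) * indicator B x \<le> ennreal ((2 * T) powr q) * (ennreal (w x) * indicator B x) +
          (\<Sum>k. ennreal ((2 ^ (k + 2) * T) powr q) * (ennreal (w x) * indicator (E k) x))"
    proof (cases "x \<in> B")
      case True
      have "ennreal (u x powr q) * ennreal (w x) \<le> (ennreal ((2 * T) powr q) +
          (\<Sum>k. ennreal ((2 ^ (k + 2) * T) powr q) * indicator {2 ^ (k + 1) * T..} (u x))) * ennreal (w x)"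
        using T q by (intro mult_right_mono powr_le_sum_layers) (auto simp: u_def)
      also have "\<dots> = ennreal ((2 * T) powr q) * ennreal (w x) +
          (\<Sum>k. ennreal ((2 ^ (k + 2) * T) powr q) * (ennreal (w x) * indicator (E k) x))"
        using True by (simp add: distrib_left distrib_right ennreal_suminf_multc[symmetric] E_def indicator_def mult_ac)
      finally show ?thesis using True by simp
    qed simp
  qed
  also have "\<dots> = ennreal ((2 * T) powr q) * wint w B + (\<Sum>k. ennreal ((2 ^ (k + 2) * T) powr q) * wint w (E k))"
    unfolding wint_def by (simp add: nn_integral_add nn_integral_cmult nn_integral_suminf)
  also have "(\<Sum>k. ennreal ((2 ^ (k + 2) * T) powr q) * wint w (E k)) \<le> ennreal (8 powr q * b * T powr q)"
  proof (rule suminf_le_const)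
    fix N
    have "(\<Sum>k<N. ennreal ((2 ^ (k + 2) * T) powr q) * wint w (E k)) = (\<Sum>k<N. ennreal ((2 ^ (k + 2) * T) powr q * e k))"
      using e by (simp add: ennreal_mult)
    also have "\<dots> = ennreal (\<Sum>k<N. (2 ^ (k + 2) * T) powr q * e k)"
      using e by (intro sum_ennreal) auto
    also have "\<dots> \<le> ennreal (8 powr q * b * T powr q)"
      by (intro ennreal_leI sum_le)
    finally show "(\<Sum>k<N. ennreal ((2 ^ (k + 2) * T) powr q) * wint w (E k)) \<le> ennreal (8 powr q * b * T powr q)" .
  qed auto
  also have "ennreal ((2 * T) powr q) * wint w B + ennreal (8 powr q * b * T powr q)
      = ennreal ((2 * T) powr q * b + 8 powr q * b * T powr q)"
    using b by (simp flip: ennreal_mult ennreal_plus)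
  also have "\<dots> \<le> ennreal ((10 * T) powr q * b)"
  proof (rule ennreal_leI)
    \<comment> \<open>This is \<open>2 powr q + 8 powr q \<le> 10 powr q\<close>, which combines the
      low values and the layers.\<close>
    have "(\<Sum>i\<in>{True, False}. (if i then 2 else 8) powr q) \<le> (\<Sum>i\<in>{True, False}. if i then 2 else 8 :: real) powr q"
      by (rule sum_powr_le_powr_sum) (auto simp: q)
    then have "(2 powr q + 8 powr q) * (T powr q * b) \<le> 10 powr q * (T powr q * b)"
      using b by (intro mult_right_mono) auto
    then show "(2 * T) powr q * b + 8 powr q * b * T powr q \<le> (10 * T) powr q * b"
      using T by (simp add: powr_mult algebra_simps)
  qed
  finally show ?thesis by (simp add: u_def q_def add_left_mono)
qed

section \<open>Poincare-Sobolev inequality\<close>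

text \<open>Dividing by \<open>(e / b) powr \<theta>\<close> leaves the mass with exponent
  \<open>1 - \<theta>\<close>; raising to the power \<open>1 / (1 - \<theta>)\<close> makes it
  linear. With \<open>\<theta> = d / DIM('a)\<close> this produces the exponent
  \<open>conj_exp (DIM('a) / d)\<close>.\<close>

lemma le_powr_conj_exp:
  fixes t p e b A \<theta> :: real
  assumes t: "0 < t" and b: "0 < b" and e: "0 \<le> e" and \<theta>: "0 < \<theta>" "\<theta> < 1" and A: "0 \<le> A"
    and le: "t powr p * e \<le> A * (e / b) powr \<theta>"
  shows "t powr (p * (1 / (1 - \<theta>))) * (e / b) \<le> (A / b) powr (1 / (1 - \<theta>))"
proof (cases "e = 0")
  case False
  define x where "x = e / b"
  have x: "0 < x" using False e b by (simp add: x_def)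
  have "t powr p * x \<le> A / b * x powr \<theta>"
    using le b by (simp add: x_def divide_right_mono field_simps)
  moreover have "x = x powr \<theta> * x powr (1 - \<theta>)" using x by (simp flip: powr_add)
  ultimately have "x powr \<theta> * (t powr p * x powr (1 - \<theta>)) \<le> x powr \<theta> * (A / b)"
    by (metis mult.commute mult.left_commute)
  then have "t powr p * x powr (1 - \<theta>) \<le> A / b"
    using x by (subst (asm) mult_le_cancel_left_pos) auto
  then have "(t powr p * x powr (1 - \<theta>)) powr (1 / (1 - \<theta>)) \<le> (A / b) powr (1 / (1 - \<theta>))"
    using \<theta> by (intro powr_mono2) auto
  also have "(t powr p * x powr (1 - \<theta>)) powr (1 / (1 - \<theta>)) = t powr (p * (1 / (1 - \<theta>))) * x"
    using t x \<theta> by (simp add: powr_mult powr_powr)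
  finally show ?thesis by (simp add: x_def)
qed simp

lemma frac_poincare_sobolev_borel:
  fixes f w :: "'a::euclidean_space \<Rightarrow> real" and p d r W b I T :: real
  assumes f_m: "f \<in> borel_measurable borel" and w_m: "w \<in> borel_measurable borel"
    and f: "set_integrable lborel (ball z r) f"
    and n: "2 \<le> DIM('a)" and p: "1 \<le> p" and d: "0 < d" "d < 1" and r: "0 < r"
    and w: "\<And>x. 0 \<le> w x" and W: "0 \<le> W"
    and A1: "AE y in lborel. \<forall>c \<rho>. 0 < \<rho> \<longrightarrow> y \<in> ball c \<rho> \<longrightarrow>
        wint w (ball c \<rho>) \<le> ennreal (W * w y) * emeasure lborel (ball c \<rho>)"
    and b: "wint w (ball z r) = ennreal b" "0 < b"
    and I: "(\<integral>\<^sup>+x\<in>ball z r. frac_grad (DIM('a) + d * p) p f (ball z r) x * ennreal (w x) \<partial>lborel) = ennreal I" "0 \<le> I"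
  defines "q \<equiv> p * (1 / (1 - d / DIM('a)))"
  shows "((\<integral>\<^sup>+x\<in>ball z r. ennreal (\<bar>f x - lavg f (ball z r)\<bar> powr q) * ennreal (w x) \<partial>lborel) / ennreal b) epowr (1 / q)
    \<le> ennreal (20 * frac_const DIM('a) * (1 - d) powr (1 / p) / d * W powr (1 / p) * r powr d * (I / b) powr (1 / p))"
proof -
  let ?B = "ball z r" and ?D = "frac_const DIM('a)"
  \<comment> \<open>The constant of the weak type estimate; its \<open>p\<close>-th root is computed
    in \<open>KI\<close>.\<close>
  define K where "K = ?D powr p * (1 - d) * W * r powr (d * p) / d powr p"
  define \<kappa> where "\<kappa> = 1 / (1 - d / DIM('a))"
  have K: "0 \<le> K" using d W by (simp add: K_def)
  have \<theta>: "0 < d / DIM('a)" "d / DIM('a) < 1" using d n by (auto simp: field_simps)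
  have \<kappa>: "1 \<le> \<kappa>" using \<theta> by (simp add: \<kappa>_def field_simps)
  have q: "q = p * \<kappa>" "1 \<le> q" using mult_mono[of 1 p 1 \<kappa>] p \<kappa> by (auto simp: q_def \<kappa>_def)
  let ?L = "\<integral>\<^sup>+x\<in>?B. ennreal (\<bar>f x - lavg f ?B\<bar> powr q) * ennreal (w x) \<partial>lborel"
  have weak: "t powr (p * \<kappa>) * (e / b) \<le> (K * I / b) powr \<kappa>"
    if "v \<in> borel_measurable borel" "set_integrable lborel ?B v" "0 < t"
      "wint w {x \<in> ?B. t \<le> \<bar>v x - lavg v ?B\<bar>} = ennreal e" "0 \<le> e"
      "(\<integral>\<^sup>+x\<in>?B. frac_grad (DIM('a) + d * p) p v ?B x * ennreal (w x) \<partial>lborel) = ennreal I" "0 \<le> I" for v t e I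
    unfolding \<kappa>_def
  proof (rule le_powr_conj_exp)
    show "t powr p * e \<le> K * I * (e / b) powr (d / DIM('a))"
      using frac_poincare_weak[OF that(1) w_m that(2) n p d r w W A1 b that(3-7)]
      by (simp add: K_def mult_ac)
  qed (use that b \<theta> K in auto)
  have bound: "(?L / ennreal b) epowr (1 / q) \<le> ennreal (10 * T)" if T: "0 < T" "2 powr (1 / q) * (K * I / b) powr (1 / p) \<le> T" for T
  proof -
    have "2 * (K * I / b) powr \<kappa> = (2 powr (1 / q) * (K * I / b) powr (1 / p)) powr q"
      using q p \<kappa> by (simp add: powr_mult powr_powr)
    also have "\<dots> \<le> T powr (p * \<kappa>)"
      unfolding q(1)[symmetric] using T q by (intro powr_mono2) auto
    finally have T2: "2 * (K * I / b) powr \<kappa> \<le> T powr (p * \<kappa>)" .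
    have "?L \<le> ennreal ((10 * T) powr q * b)"
      unfolding q(1) by (rule truncation_strong_of_weak[OF f_m w_m _ f _ p \<kappa> K b weak I T(1) T2]) (auto simp: emeasure_lborel_ball_finite[unfolded infinity_ennreal_def])
    then obtain l where l: "?L = ennreal l" "0 \<le> l" "l \<le> (10 * T) powr q * b"
      using b by (cases ?L) (auto simp: top_unique)
    have "(?L / ennreal b) epowr (1 / q) = ennreal ((l / b) powr (1 / q))"
      using l b by (simp add: divide_ennreal ennreal_epowr)
    also have "\<dots> \<le> ennreal (((10 * T) powr q) powr (1 / q))"
      using l b q by (intro ennreal_leI powr_mono2) (auto simp: field_simps)
    also have "((10 * T) powr q) powr (1 / q) = 10 * T"
      using q T p \<kappa> by (simp add: powr_powr)
    finally show ?thesis .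
  qed
  have two: "2 powr (1 / q) \<le> (2::real)" using powr_mono[of "1 / q" 1 "2::real"] q by simp
  have KI: "(K * I / b) powr (1 / p) = ?D * (1 - d) powr (1 / p) / d * W powr (1 / p) * r powr d * (I / b) powr (1 / p)"
    using frac_const_ge_1[of "DIM('a)"] d r W I b p unfolding K_def
    by (simp add: powr_mult powr_divide powr_powr)
  show ?thesis
  proof (rule ennreal_le_epsilon)
    fix \<epsilon> :: real assume \<epsilon>: "0 < \<epsilon>"
    \<comment> \<open>The truncation level has to be positive although \<open>K * I\<close> may
      vanish, hence the \<open>\<epsilon>\<close>. The factor 2 dominates
      \<open>2 powr (1 / q)\<close>, and with the 10 of the truncation lemma it gives the constant
      20.\<close>
    let ?T = "2 * (K * I / b) powr (1 / p) + \<epsilon> / 10"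
    have "2 powr (1 / q) * (K * I / b) powr (1 / p) \<le> 2 * (K * I / b) powr (1 / p)"
      using two by (intro mult_right_mono) auto
    then have "(?L / ennreal b) epowr (1 / q) \<le> ennreal (10 * ?T)"
      using \<epsilon> by (intro bound) (auto intro!: add_nonneg_pos)
    also have "10 * ?T = 20 * (K * I / b) powr (1 / p) + \<epsilon>" by simp
    also have "ennreal (20 * (K * I / b) powr (1 / p) + \<epsilon>) = ennreal (20 * (K * I / b) powr (1 / p)) + ennreal \<epsilon>"
      using \<epsilon> by (intro ennreal_plus) auto
    also have "20 * (K * I / b) powr (1 / p) = 20 * ?D * (1 - d) powr (1 / p) / d * W powr (1 / p) * r powr d * (I / b) powr (1 / p)"
      unfolding KI by simp
    finally show "(?L / ennreal b) epowr (1 / q)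
        \<le> ennreal (20 * ?D * (1 - d) powr (1 / p) / d * W powr (1 / p) * r powr d * (I / b) powr (1 / p)) + ennreal \<epsilon>" .
  qed
qed

section \<open>Transfer to Lebesgue measurable functions and weights in \<open>A1\<close>\<close>

lemma A1_AE_ball_le:
  fixes w :: "'a::euclidean_space \<Rightarrow> real"
  assumes "w \<in> A1"
  shows "AE y in lborel. \<forall>c \<rho>. 0 < \<rho> \<longrightarrow> y \<in> ball c \<rho> \<longrightarrow>
    wmeas w (ball c \<rho>) \<le> ennreal (enn2real (A1_const w) * w y) * emeasure lborel (ball c \<rho>)"
proof -
  define W where "W = enn2real (A1_const w)"
  have W: "A1_const w = ennreal W" "0 \<le> W" and w: "\<And>x. 0 \<le> w x"
    using assms by (auto simp: A1_def W_def weight_def)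
  \<comment> \<open>The supremum over the balls sits inside \<open>maximal_fun\<close>, so one null
    set serves all balls at once.\<close>
  have "AE y in lebesgue. maximal_fun w y / ennreal (w y) \<le> ennreal W"
    unfolding W(1)[symmetric] A1_const_def by (rule esssup_AE)
  then have "AE y in lborel. maximal_fun w y / ennreal (w y) \<le> ennreal W"
    by (simp add: AE_completion_iff)
  then have "AE y in lborel. \<forall>c \<rho>. 0 < \<rho> \<longrightarrow> y \<in> ball c \<rho> \<longrightarrow>
    wmeas w (ball c \<rho>) \<le> ennreal (W * w y) * emeasure lborel (ball c \<rho>)"
  proof eventually_elim
    case (elim y)
    have max_le: "maximal_fun w y \<le> ennreal (W * w y)"
    proof (cases "w y = 0")
      case True
      \<comment> \<open>Otherwise the quotient by \<open>w y = 0\<close> would be infinite and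
        exceed \<open>W\<close>.\<close>
      then have "maximal_fun w y = 0"
        using elim by (intro ccontr[of "maximal_fun w y = 0"]) (simp add: divide_ennreal_def ennreal_mult_top top_unique)
      then show ?thesis by simp
    next
      case False
      then have "maximal_fun w y = maximal_fun w y / ennreal (w y) * ennreal (w y)"
        using w[of y] by (simp add: ennreal_divide_times ennreal_times_divide mult_divide_eq_ennreal ennreal_eq_0_iff)
      also have "\<dots> \<le> ennreal W * ennreal (w y)"
        by (intro mult_right_mono elim) simp
      finally show ?thesis using W w by (simp add: ennreal_mult)
    qed
    show ?case
    proof (intro allI impI)
      fix c and \<rho> :: real assume \<rho>: "0 < \<rho>" and y: "y \<in> ball c \<rho>"
      define v where "v = unit_ball_vol DIM('a) * \<rho> ^ DIM('a)"
      have v: "emeasure lborel (ball c \<rho>) = ennreal v" "0 < v"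
        using \<rho> by (auto simp: v_def emeasure_ball)
      have "(\<integral>\<^sup>+x\<in>ball c \<rho>. ennreal \<bar>w x\<bar> \<partial>lebesgue) / emeasure lebesgue (ball c \<rho>) * indicator (ball c \<rho>) y \<le> maximal_fun w y"
        unfolding maximal_fun_def using \<rho> by (intro SUP_upper) auto
      then have "wmeas w (ball c \<rho>) / ennreal v \<le> ennreal (W * w y)"
        using max_le y w v by (simp add: wmeas_def)
      then have "wmeas w (ball c \<rho>) / ennreal v * ennreal v \<le> ennreal (W * w y) * ennreal v"
        by (intro mult_right_mono) auto
      also have "wmeas w (ball c \<rho>) / ennreal v * ennreal v = wmeas w (ball c \<rho>)"
        using v by (simp add: ennreal_divide_times ennreal_times_divide mult_divide_eq_ennreal ennreal_eq_0_iff)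
      finally show "wmeas w (ball c \<rho>) \<le> ennreal (W * w y) * emeasure lborel (ball c \<rho>)"
        using v by simp
    qed
  qed
  then show ?thesis by (simp add: W_def)
qed

text \<open>A weight is only known to be integrable on compact sets, so it is taken as the limit of
  its restrictions to growing closed balls.\<close>

lemma weight_borel_measurable:
  fixes w :: "'a::euclidean_space \<Rightarrow> real"
  assumes "weight w"
  shows "w \<in> borel_measurable lebesgue"
proof (rule borel_measurable_LIMSEQ_real)
  show "(\<lambda>x. indicator (cball 0 (real i)) x *\<^sub>R w x) \<in> borel_measurable lebesgue" for i
    using assms by (auto simp: weight_def set_integrable_def intro!: borel_measurable_integrable)
  show "(\<lambda>i. indicator (cball 0 (real i)) x *\<^sub>R w x) \<longlonglongrightarrow> w x" for x
  proof (rule tendsto_eventually)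
    obtain N where N: "norm x \<le> real N" using real_arch_simple by blast
    show "\<forall>\<^sub>F i in sequentially. indicator (cball 0 (real i)) x *\<^sub>R w x = w x"
      using eventually_ge_at_top[of N] by eventually_elim (use N in auto)
  qed
qed

text \<open>Replaces \<open>w\<close> and \<open>f\<close> by Borel functions \<open>v\<close> and
  \<open>g\<close> that agree with them almost everywhere, on \<open>B\<close> in the case of
  \<open>f\<close>. Mass zero and infinite energy are treated apart, since the Borel version needs
  \<open>0 < b\<close> and a finite \<open>I\<close>.\<close>

lemma frac_poincare_sobolev_A1:
  fixes w f :: "'a::euclidean_space \<Rightarrow> real" and z :: 'a and \<delta> p r :: real
  assumes n: "2 \<le> DIM('a)" and \<delta>: "0 < \<delta>" "\<delta> < 1" and p: "1 \<le> p" and w: "w \<in> A1"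
    and r: "0 < r" and f: "set_integrable lebesgue (ball z r) f"
  defines "B \<equiv> ball z r" and "q \<equiv> p * conj_exp (DIM('a) / \<delta>)"
  shows "((\<integral>\<^sup>+x\<in>B. ennreal (\<bar>f x - avg f B\<bar> powr q * w x) \<partial>lebesgue) / wmeas w B) epowr (1 / q)
    \<le> ennreal (20 * frac_const DIM('a) * (1 - \<delta>) powr (1 / p) / \<delta> powr (1 + 1 / conj_exp p))
      * A1_const w epowr (1 / p) * ennreal (r powr \<delta>)
      * ((\<integral>\<^sup>+x\<in>B. (\<integral>\<^sup>+y\<in>B. ennreal (\<bar>f x - f y\<bar> powr p / norm (x - y) powr (DIM('a) + \<delta> * p)) \<partial>lebesgue)
            * ennreal (w x) \<partial>lebesgue) / wmeas w B) epowr (1 / p)"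
    (is "?L \<le> ?R")
proof -
  define a where "a = DIM('a) + \<delta> * p"
  define W where "W = enn2real (A1_const w)"
  have W: "A1_const w = ennreal W" "0 \<le> W" and w0: "\<And>x. 0 \<le> w x" and wt: "weight w"
    using w by (auto simp: A1_def W_def weight_def)
  have q: "q = p * (1 / (1 - \<delta> / DIM('a)))"
    using n \<delta> by (simp add: q_def conj_exp_div field_simps)
  have Bm [measurable]: "B \<in> sets borel" by (simp add: B_def)
  obtain v' where v': "v' \<in> borel_measurable lborel" "AE x in lborel. w x = v' x"
    using completion_ex_borel_measurable_real[OF weight_borel_measurable[OF wt]] by auto
  \<comment> \<open>The maximum makes the representative nonnegative at every point, not only almost
    everywhere.\<close>
  define v where "v x = max 0 (v' x)" for x
  have vm [measurable]: "v \<in> borel_measurable borel" using v'(1) unfolding v_def by simp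
  have v0: "0 \<le> v x" for x by (simp add: v_def)
  have wv: "AE x in lborel. w x = v x"
    using v'(2) by eventually_elim (use w0 in \<open>auto simp: v_def max_def\<close>, metis order_antisym)
  \<comment> \<open>Nothing is known about \<open>f\<close> outside \<open>B\<close>, so a Borel
    representative is taken of its extension by zero.\<close>
  have "(\<lambda>x. indicator B x *\<^sub>R f x) \<in> borel_measurable lebesgue"
    using f by (auto simp: set_integrable_def B_def intro: borel_measurable_integrable)
  then obtain g where g: "g \<in> borel_measurable lborel" and fg': "AE x in lborel. indicator B x *\<^sub>R f x = g x"
    using completion_ex_borel_measurable_real by blast
  have gm [measurable]: "g \<in> borel_measurable borel" using g by simp
  have fg: "AE x in lborel. x \<in> B \<longrightarrow> f x = g x"
    using fg' by eventually_elim auto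
  have wm: "wmeas w S = wint v S" for S
    unfolding wmeas_def wint_def nn_integral_completion
    by (intro nn_integral_cong_AE) (use wv in eventually_elim, simp)
  have fgB: "AE x in lebesgue. indicator B x *\<^sub>R f x = indicator B x *\<^sub>R g x"
    by (rule AE_completion) (use fg in \<open>eventually_elim, auto simp: indicator_def\<close>)
  have gBm: "(\<lambda>x. indicator B x *\<^sub>R g x) \<in> borel_measurable lborel" by simp
  have fBm: "(\<lambda>x. indicator B x *\<^sub>R f x) \<in> borel_measurable lebesgue" by fact
  have "integrable lebesgue (\<lambda>x. indicator B x *\<^sub>R g x)"
    using f fgB fBm measurable_completion[OF gBm] integrable_cong_AE[OF fBm measurable_completion[OF gBm] fgB]
    by (simp add: set_integrable_def B_def)
  then have gi: "set_integrable lborel B g"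
    unfolding set_integrable_def using gBm by (simp add: integrable_completion)
  have av: "avg f B = lavg g B"
  proof -
    have "(LINT x:B|lebesgue. f x) = (LINT x:B|lebesgue. g x)"
      unfolding set_lebesgue_integral_def by (rule integral_cong_AE[OF fBm measurable_completion[OF gBm] fgB])
    also have "\<dots> = (LINT x:B|lborel. g x)"
      unfolding set_lebesgue_integral_def by (rule integral_completion[OF gBm])
    finally show ?thesis by (simp add: avg_def lavg_def)
  qed
  have L: "(\<integral>\<^sup>+x\<in>B. ennreal (\<bar>f x - avg f B\<bar> powr q * w x) \<partial>lebesgue)
      = (\<integral>\<^sup>+x\<in>B. ennreal (\<bar>g x - lavg g B\<bar> powr q) * ennreal (v x) \<partial>lborel)"
    unfolding nn_integral_completion av
  proof (rule nn_integral_cong_AE)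
    show "AE x in lborel. ennreal (\<bar>f x - lavg g B\<bar> powr q * w x) * indicator B x
        = ennreal (\<bar>g x - lavg g B\<bar> powr q) * ennreal (v x) * indicator B x"
      using fg wv by eventually_elim (auto simp: indicator_def ennreal_mult v0)
  qed
  have G: "(\<integral>\<^sup>+x\<in>B. (\<integral>\<^sup>+y\<in>B. ennreal (\<bar>f x - f y\<bar> powr p / norm (x - y) powr a) \<partial>lebesgue) * ennreal (w x) \<partial>lebesgue)
      = (\<integral>\<^sup>+x\<in>B. frac_grad a p g B x * ennreal (v x) \<partial>lborel)"
    unfolding nn_integral_completion
  proof (rule nn_integral_cong_AE)
    have inner: "(\<integral>\<^sup>+y\<in>B. ennreal (\<bar>f x - f y\<bar> powr p / norm (x - y) powr a) \<partial>lborel) = frac_grad a p g B x"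
      if "f x = g x" for x
      unfolding frac_grad_def that
      by (intro nn_integral_cong_AE) (use fg in \<open>eventually_elim, auto simp: indicator_def\<close>)
    show "AE x in lborel. (\<integral>\<^sup>+y\<in>B. ennreal (\<bar>f x - f y\<bar> powr p / norm (x - y) powr a) \<partial>lborel) * ennreal (w x) * indicator B x
        = frac_grad a p g B x * ennreal (v x) * indicator B x"
      using fg wv
    proof eventually_elim
      case (elim x)
      show ?case
      proof (cases "x \<in> B")
        case True
        then have e: "f x = g x" using elim by simp
        show ?thesis unfolding inner[OF e] using elim by simp
      qed simp
    qed
  qed
  have A1v: "AE y in lborel. \<forall>c \<rho>. 0 < \<rho> \<longrightarrow> y \<in> ball c \<rho> \<longrightarrow>
      wint v (ball c \<rho>) \<le> ennreal (W * v y) * emeasure lborel (ball c \<rho>)"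
    using A1_AE_ball_le[OF w] wv unfolding wm W_def by eventually_elim simp
  have "wint v B \<noteq> \<infinity>"
  proof -
    \<comment> \<open>The closed ball is compact, so local integrability of \<open>w\<close> applies
      to it.\<close>
    have "wint v B \<le> wmeas w (cball z r)"
      unfolding wm by (rule wint_mono) (auto simp: B_def)
    also have "\<dots> < \<infinity>"
    proof -
      have "integrable lebesgue (\<lambda>x. indicator (cball z r) x *\<^sub>R w x)"
        using wt by (simp add: weight_def set_integrable_def)
      then have "(\<integral>\<^sup>+x. ennreal (indicator (cball z r) x *\<^sub>R w x) \<partial>lebesgue) < \<infinity>"
        by (subst nn_integral_eq_integral) (auto simp: w0)
      moreover have "(\<integral>\<^sup>+x. ennreal (indicator (cball z r) x *\<^sub>R w x) \<partial>lebesgue) = wmeas w (cball z r)"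
        unfolding wmeas_def by (intro nn_integral_cong) (auto simp: indicator_def)
      ultimately show ?thesis by simp
    qed
    finally show ?thesis by simp
  qed
  then obtain b where b: "wint v B = ennreal b" "0 \<le> b" by (cases "wint v B") auto
  show ?thesis
  proof (cases "b = 0")
    case True
    then have "AE x in lborel. ennreal (v x) * indicator B x = 0"
      using b by (subst nn_integral_0_iff_AE[symmetric]) (auto simp: wint_def)
    then have "(\<integral>\<^sup>+x\<in>B. ennreal (\<bar>g x - lavg g B\<bar> powr q) * ennreal (v x) \<partial>lborel) = (\<integral>\<^sup>+x. 0 \<partial>(lborel :: 'a measure))"
      by (intro nn_integral_cong_AE, eventually_elim) (auto simp: mult.assoc)
    \<comment> \<open>The numerator vanishes together with the mass, and
      \<open>0 / 0 = 0\<close>.\<close>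
    then have "?L = 0" unfolding L by (simp add: enn_powr_def)
    then show ?thesis by simp
  next
    case False
    then have b0: "0 < b" using b by simp
    \<comment> \<open>As \<open>0 * \<infinity> = 0\<close>, infinite energy makes the right side
      infinite only if the \<open>A1\<close> constant is positive. It is, because
      \<open>W = 0\<close> would force \<open>B\<close> to have no mass.\<close>
    have W0: "0 < W"
    proof (rule ccontr)
      assume "\<not> 0 < W"
      then have "AE y in lborel. y \<notin> B"
        using A1v W(2) b(1) b0 r by (auto simp: B_def elim!: eventually_mono)
      then have "emeasure lborel B = 0"
        by (subst (asm) AE_iff_measurable[OF _ refl]) auto
      then show False
        using r less_imp_neq[OF unit_ball_vol_pos[of "real DIM('a)"]] by (simp add: B_def emeasure_ball)
    qed
    define c where "c = 20 * frac_const DIM('a) * (1 - \<delta>) powr (1 / p) / \<delta> powr (1 + 1 / conj_exp p)"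
    have c: "0 < c" using frac_const_ge_1[of "DIM('a)"] \<delta> by (simp add: c_def)
    show ?thesis
    proof (cases "\<integral>\<^sup>+x\<in>B. frac_grad a p g B x * ennreal (v x) \<partial>lborel")
      case (real I)
      have "?L = ((\<integral>\<^sup>+x\<in>B. ennreal (\<bar>g x - lavg g B\<bar> powr q) * ennreal (v x) \<partial>lborel) / ennreal b) epowr (1 / q)"
        unfolding L wm b ..
      also have "\<dots> \<le> ennreal (20 * frac_const DIM('a) * (1 - \<delta>) powr (1 / p) / \<delta> * W powr (1 / p) * r powr \<delta> * (I / b) powr (1 / p))"
        using frac_poincare_sobolev_borel[OF gm vm gi[unfolded B_def] n p \<delta> r v0 W(2) A1v b(1)[unfolded B_def] b0] real
        unfolding q B_def a_def by blast
      also have "\<dots> \<le> ennreal (20 * frac_const DIM('a) * (1 - \<delta>) powr (1 / p) / \<delta> powr (1 + 1 / conj_exp p) * W powr (1 / p) * r powr \<delta> * (I / b) powr (1 / p))"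
      \<comment> \<open>Since \<open>\<delta> < 1\<close>, dividing by the higher power of
        \<open>\<delta>\<close> only enlarges the bound.\<close>
      proof (intro ennreal_leI mult_right_mono divide_left_mono)
        have "0 \<le> 1 / conj_exp p" using p by (simp add: conj_exp_def)
        then show "\<delta> powr (1 + 1 / conj_exp p) \<le> \<delta>"
          using \<delta> powr_mono'[of 1 "1 + 1 / conj_exp p" \<delta>] by simp
      qed (use frac_const_ge_1[of "DIM('a)"] \<delta> in auto)
      also have "\<dots> = ?R"
        using c b0 real
        unfolding a_def[symmetric] c_def[symmetric] G wm b W by (simp add: divide_ennreal ennreal_epowr W(2) ennreal_mult)
      finally show ?thesis .
    next
      case top
      have "?R = \<infinity>"
        using c b0 W0 r
        unfolding a_def[symmetric] c_def[symmetric] G wm b W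
        by (simp add: top ennreal_epowr enn_powr_def ennreal_mult_eq_top_iff ennreal_top_divide ennreal_eq_0_iff)
      then show ?thesis by simp
    qed
  qed
qed

theorem theorem2p7:
  assumes "CARD('n::finite) \<ge> 2"
  shows "\<exists>c::real. c > 0 \<and>
    (\<forall>(\<delta>::real) (p::real) (w :: real^'n \<Rightarrow> real) (z :: real^'n) (r::real) (f :: real^'n \<Rightarrow> real).
      0 < \<delta> \<longrightarrow> \<delta> < 1 \<longrightarrow> 1 \<le> p \<longrightarrow> p < real CARD('n) / \<delta> \<longrightarrow> w \<in> A1 \<longrightarrow>
      0 < r \<longrightarrow> set_integrable lebesgue (ball z r) f \<longrightarrow>
      (let n = real CARD('n); B = ball z r; q = p * conj_exp (n / \<delta>) in
        ((\<integral>\<^sup>+x\<in>B. ennreal (\<bar>f x - avg f B\<bar> powr q * w x) \<partial>lebesgue) / wmeas w B) epowr (1 / q)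
        \<le> ennreal (c * (1 - \<delta>) powr (1 / p) / \<delta> powr (1 + 1 / conj_exp p))
          * A1_const w epowr (1 / p) * ennreal (r powr \<delta>)
          * ((\<integral>\<^sup>+x\<in>B. (\<integral>\<^sup>+y\<in>B. ennreal (\<bar>f x - f y\<bar> powr p / norm (x - y) powr (n + \<delta> * p)) \<partial>lebesgue)
                * ennreal (w x) \<partial>lebesgue) / wmeas w B) epowr (1 / p)))"
proof (intro exI conjI allI impI)
  show "0 < 20 * frac_const CARD('n)" using frac_const_ge_1[of "CARD('n)"] by simp
qed (unfold Let_def, use frac_poincare_sobolev_A1[where 'a = "real^'n"] assms in simp)

end
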